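(* Let $k>0$ and $\alpha\in\,]0,1[$. Let $\lambda\in\mathbb{C}$ and $\sigma>0$. Let $a$, $b$ and $\psi$ be holomorphic functions on $[-1,1]_\sigma$ and let $\Phi$ be an entire function. Assume that $a$ is not identically vanishing, that there exist constants $\alpha_0,\beta_0>0$ such that $$|\Phi(z)|\le \alpha_0 e^{\beta_0|z|},\qquad z\in\mathbb{C},$$ and that $\psi$ satisfies the property $\mathcal{S}(k)$ on the interval $[-1,1]$. Put $$L:=\frac{1}{\beta_0}\ln\left(\frac{\alpha\Gamma(\alpha)}{\alpha_0\beta_0 2^{\alpha}\|a\|_{\infty,[-1,1]}}\right).$$ Assume moreover that the following conditions are fulfilled: $$a(-1)=b(-1)=0,$$ $$\frac{2^{\alpha}}{\alpha\Gamma(\alpha)}\|b\|_{\infty,[-1,1]}+|\lambda|<\frac{1}{\beta_0}\ln\left(\frac{\alpha\Gamma(\alpha)}{e\,\alpha_0\beta_0 2^{\alpha}\|a\|_{\infty,[-1,1]}}\right),$$ $$\|a\|_{\infty,[-1,1]}\,\|\Phi\|_{\infty,[-L,L]}+\|b\|_{\infty,[-1,1]}<1,$$ $$\|a\|_{\infty,[-1,1]}\,\|\Phi'\|_{\infty,[-L,L]}<\frac{\alpha\Gamma(\alpha)}{2^{\alpha}},$$ $$\|\psi'\|_{\infty,[-1,1]}\le 1+\alpha.$$ Then the fractional functional differential equation $${}^cD_{-1}^{\alpha}y(t)=a(t)\,\Phi(y(\psi(t)))+b(t),\qquad t\in[-1,1],$$ has a solution $u$ which belongs to the Gevrey class $G_{k,-1}([-1,1])$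 and verifies the initial condition $u(-1)=\lambda$.
   Context: Notation. For a bounded function $f:S\to\mathbb{C}$, $\|f\|_{\infty,S}:=\sup_{z\in S}|f(z)|$. $\Gamma$ is the classical Gamma function. $[-L,L]$ denotes a real interval. For a nontrivial compact interval $[q_1,q_2]\subset\mathbb{R}$, $r>0$, $l>0$ and an integer $n\ge1$: $[q_1,q_2]_r:=\{x+\zeta: x\in[q_1,q_2],\ \zeta\in\mathbb{C},\ |\zeta|<r\}$; $[q_1,q_2]^{r}:=\{q_1+se^{i\theta}: s\in\,]0,q_2-q_1+r[,\ \theta\in\,]-r,r[\}$; $[q_1,q_2]^{l,r,n}:=[q_1,q_2]^{rn^{-1/l}}$. Caputo derivative. For $\delta\in\,]0,1[$ and $f:[q_1,q_2]\to\mathbb{C}$ absolutely continuous, $${}^cD_{q_1}^{\delta}f(t):=\frac{1}{\Gamma(1-\delta)}\int_{q_1}^{t}(t-s)^{-\delta}f'(s)\,ds,\quad t\in[q_1,q_2].$$ Gevrey classes. For $l>0$, $G_l([q_1,q_2])$ is the set of all functions $f$ of class $C^\infty$ on $[q_1,q_2]$ for which there is a constant $B>0$ with $\|f^{(n)}\|_{\infty,[q_1,q_2]}\le B^{n+1}n^{n(1+1/l)}$ for all $n\in\mathbb{N}$ (with $0^0=1$). The Gevrey class of bound $q_1$ and index $l$, $G_{l,q_1}([q_1,q_2])$, is the set of all functions $f$ of class $C^1$ on $[q_1,q_2]$ and of class $C^\infty$ on $]q_1,q_2]$ such that $f_{|[q,q_2]}\in G_l([q,q_2])$ for every $q\in\,]q_1,q_2[$.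 Property $\mathcal{S}(l)$. A function $\varphi$ defined on $\{q_1\}\cup[q_1,q_2]^r$ (for some $r\in\,]0,\pi[$) satisfies the property $\mathcal{S}(l)$ on $[q_1,q_2]$ if $\varphi_{|[q_1,q_2]^r}$ is holomorphic on $[q_1,q_2]^r$, $\varphi_{|[q_1,q_2]}$ is of class $C^1$ on $[q_1,q_2]$, and there exists a constant $\tau_\varphi\in\,]0,\pi[$ such that for all $D\in\,]0,\tau_\varphi]$ there exists an integer $N_{l,\varphi}(D)\ge1$, depending only on $D,l,\varphi$, such that $$\varphi([q_1,q_2]^{l,D,n+1})\subset[q_1,q_2]^{l,D,n}$$ for every integer $n\ge N_{l,\varphi}(D)$. A function defined on a larger set is said to satisfy $\mathcal{S}(l)$ when its restriction to $\{q_1\}\cup[q_1,q_2]^r$ does, for some $r\in\,]0,\pi[$. *)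

theory Defs
  imports "HOL-Complex_Analysis.Complex_Analysis"
begin

definition sup_norm :: "'a set \<Rightarrow> ('a \<Rightarrow> complex) \<Rightarrow> real" where
  "sup_norm S f = (SUP z\<in>S. norm (f z))"

definition real_segment :: "real \<Rightarrow> real \<Rightarrow> complex set" where
  "real_segment p q = complex_of_real ` {p..q}"


definition nbhd :: "real \<Rightarrow> real \<Rightarrow> real \<Rightarrow> complex set" where
  "nbhd q1 q2 r = {complex_of_real x + \<zeta> | x \<zeta>. x \<in> {q1..q2} \<and> norm \<zeta> < r}"

definition sector :: "real \<Rightarrow> real \<Rightarrow> real \<Rightarrow> complex set" where
  "sector q1 q2 r =
     {complex_of_real q1 + complex_of_real s * exp (\<i> * complex_of_real \<theta>) | s \<theta>.
        s \<in> {0<..<q2 - q1 + r} \<and> \<theta> \<in> {-r<..<r}}"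

definition sector_seq :: "real \<Rightarrow> real \<Rightarrow> real \<Rightarrow> real \<Rightarrow> nat \<Rightarrow> complex set" where
  "sector_seq q1 q2 l r n = sector q1 q2 (r * real n powr (- 1 / l))"


text \<open>Derivatives of functions on an interval \<open>S\<close> are taken within \<open>S\<close> (one-sided at end
  points belonging to \<open>S\<close>), so they depend only on the values of the function on \<open>S\<close>.\<close>

definition nth_deriv_on :: "real set \<Rightarrow> nat \<Rightarrow> (real \<Rightarrow> complex) \<Rightarrow> real \<Rightarrow> complex" where
  "nth_deriv_on S n f = ((\<lambda>g x. vector_derivative g (at x within S)) ^^ n) f"

definition Ck_on :: "nat \<Rightarrow> real set \<Rightarrow> (real \<Rightarrow> complex) \<Rightarrow> bool" where
  "Ck_on n S f \<longleftrightarrow>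
     (\<forall>j<n. \<forall>x\<in>S. nth_deriv_on S j f differentiable (at x within S)) \<and>
     continuous_on S (nth_deriv_on S n f)"

definition Cinf_on :: "real set \<Rightarrow> (real \<Rightarrow> complex) \<Rightarrow> bool" where
  "Cinf_on S f \<longleftrightarrow> (\<forall>n. Ck_on n S f)"


text \<open>The Caputo derivative of order \<open>\<delta>\<close> of an absolutely continuous function. The two-sided
  derivative under the integral differs from the one within the interval only at the end points,
  and its value at points where it does not exist is irrelevant, both being null sets.\<close>

definition caputo :: "real \<Rightarrow> real \<Rightarrow> (real \<Rightarrow> complex) \<Rightarrow> real \<Rightarrow> complex" where
  "caputo q1 \<delta> f t =
     complex_of_real (1 / Gamma (1 - \<delta>)) *
     (LINT s:{q1..t}|lebesgue. complex_of_real ((t - s) powr (- \<delta>)) * vector_derivative f (at s))"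


text \<open>The bound \<open>n ^ (n (1 + 1/l))\<close> is written as a \<open>powr\<close> of \<open>n ^ n\<close>
  because \<open>0 ^ 0 = 1\<close>, as required for \<open>n = 0\<close>, whereas \<open>0 powr 0 = 0\<close>.\<close>

definition gevrey :: "real \<Rightarrow> real \<Rightarrow> real \<Rightarrow> (real \<Rightarrow> complex) set" where
  "gevrey l q1 q2 =
     {f. Cinf_on {q1..q2} f \<and>
         (\<exists>B>0. \<forall>n. sup_norm {q1..q2} (nth_deriv_on {q1..q2} n f)
                     \<le> B ^ (n + 1) * (real n ^ n) powr (1 + 1 / l))}"

definition gevrey_bound :: "real \<Rightarrow> real \<Rightarrow> real \<Rightarrow> (real \<Rightarrow> complex) set" where
  "gevrey_bound l q1 q2 =
     {f. Ck_on 1 {q1..q2} f \<and> Cinf_on {q1<..q2} f \<and> (\<forall>q\<in>{q1<..<q2}. f \<in> gevrey l q q2)}"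


text \<open>The choice of \<open>r\<close> (and hence the domain of \<open>\<phi>\<close>) only enters through holomorphy: if the
  property holds for some \<open>r\<close> it holds for every smaller one, and \<open>N\<close> may be enlarged so that all
  the sectors involved lie in the sector of parameter \<open>r\<close>.\<close>

definition property_S :: "real \<Rightarrow> real \<Rightarrow> real \<Rightarrow> (complex \<Rightarrow> complex) \<Rightarrow> bool" where
  "property_S l q1 q2 \<phi> \<longleftrightarrow>
     (\<exists>r\<in>{0<..<pi}. \<phi> holomorphic_on sector q1 q2 r) \<and>
     Ck_on 1 {q1..q2} (\<lambda>t. \<phi> (complex_of_real t)) \<and>
     (\<exists>\<tau>\<in>{0<..<pi}. \<forall>D\<in>{0<..\<tau>}. \<exists>N\<ge>1. \<forall>n\<ge>N.
        \<phi> ` sector_seq q1 q2 l D (n + 1) \<subseteq> sector_seq q1 q2 l D n)"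


text \<open>\<open>y\<close> solves \<open>D\<^sup>\<alpha> y = a \<cdot> \<Phi> (y \<circ> \<psi>) + b\<close> on \<open>[q1, q2]\<close>. As \<open>y\<close> lives on the real
  interval, \<open>y (\<psi> t)\<close> makes sense only if \<open>\<psi> t\<close> is a real point \<open>s\<close> of it; this is part of being
  a solution.\<close>

definition solves_fde ::
  "real \<Rightarrow> real \<Rightarrow> real \<Rightarrow> (complex \<Rightarrow> complex) \<Rightarrow> (complex \<Rightarrow> complex) \<Rightarrow> (complex \<Rightarrow> complex) \<Rightarrow>
   (complex \<Rightarrow> complex) \<Rightarrow> (real \<Rightarrow> complex) \<Rightarrow> bool" where
  "solves_fde q1 q2 \<alpha> a b \<Phi> \<psi> y \<longleftrightarrow>
     (\<forall>t\<in>{q1..q2}. \<exists>s\<in>{q1..q2}. \<psi> (complex_of_real t) = complex_of_real s \<and>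
        caputo q1 \<alpha> y t = a (complex_of_real t) * \<Phi> (y s) + b (complex_of_real t))"

end

theory Submission
  imports Defs
begin

text \<open>Integrating the equation turns it into the fixed point problem \<open>y = T y\<close>, where
\<open>T y = \<lambda> + I\<^sup>\<alpha> (a \<cdot> \<Phi> (y \<circ> \<psi>) + b)\<close> and \<open>I\<^sup>\<alpha>\<close> is the Riemann-Liouville integral. Along the segment
from \<open>q1\<close> to a complex point \<open>z\<close> the same formula defines \<open>T y\<close> on sectors with vertex \<open>q1\<close>, and
property \<open>S(k)\<close> says precisely that \<open>y\<close> on the \<open>n\<close>-th sector determines \<open>T y\<close> on the
\<open>(n+1)\<close>-st. The growth bound on \<open>\<Phi>\<close> and the choice of \<open>L\<close> make \<open>T\<close> send functions bounded by \<open>L\<close>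
to functions bounded by \<open>\<theta> L\<close> with \<open>\<theta> < 1\<close>: since
\<open>\<alpha>0 e^(\<beta>0 L) \<cdot> 2^\<alpha> \<parallel>a\<parallel> / \<Gamma>(\<alpha>+1) = 1 / \<beta>0\<close>, this is the smallness
condition on \<open>b\<close> and \<open>\<lambda>\<close>, and by compactness it persists on all thin enough sectors.

A holomorphic map of a ball strictly into itself is a contraction (Earle-Hamilton). As the norms
are suprema, this needs only the Schwarz-Pick lemma: measure the distance of two functions
by the supremum of the pseudo-hyperbolic distance of their values in the disc of radius \<open>L\<close>, join
them pointwise by analytic discs \<open>h \<zeta>\<close>, and apply Schwarz-Pick to the scalar function
\<open>\<zeta> \<mapsto> T (h \<zeta>) z\<close> (lemma \<open>pseudo_hyperbolic_contraction\<close>). The factor \<open>2\<theta> / (1 + \<theta>\<^sup>2) < 1\<close> is the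
same for all sectors, so the iterates \<open>Y\<close>, started at the constant \<open>\<lambda>\<close>, differ by
\<open>O(\<kappa>^n)\<close> on sectors of opening \<open>D n^(-1/k)\<close>.

Cauchy's inequalities on discs of radius comparable to \<open>n^(-1/k) (t - q1)\<close> then bound the
derivatives of the sum of the differences by \<open>m! \<Sum> \<kappa>^n n^(m/k)\<close> up to geometric factors, and this is
the Gevrey estimate (lemmas \<open>gevrey_weight\<close> and \<open>holomorphic_series_on_shrinking_sectors\<close>). The same
series argument for \<open>\<Phi> (y \<circ> \<psi>)\<close> bounds its derivative by \<open>O(1 / (t - q1))\<close>; because \<open>a\<close> vanishes
at \<open>q1\<close>, the right-hand side \<open>F\<close> of the equation has a bounded derivative and \<open>F q1 = 0\<close>. The
semigroup law \<open>I\<^sup>\<beta> I\<^sup>\<gamma> = I\<^sup>(\<beta>+\<gamma>)\<close> finally shows that \<open>\<lambda> + I\<^sup>\<alpha> F\<close> is of class \<open>C\<^sup>1\<close> up to \<open>q1\<close>, with derivative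
\<open>I\<^sup>\<alpha> F'\<close>, and that its Caputo derivative is \<open>I\<^sup>1 F' = F\<close> (lemma \<open>caputo_fractional_integral\<close>).\<close>
section \<open>Integrals depending holomorphically on a parameter\<close>

lemma riemann_sum_close:
  fixes g :: "real \<Rightarrow> complex"
  assumes cont: "continuous_on {0..1} g" and N: "N > 0"
    and osc: "\<And>s t. s \<in> {0..1} \<Longrightarrow> t \<in> {0..1} \<Longrightarrow> \<bar>s - t\<bar> \<le> 1 / real N \<Longrightarrow> norm (g s - g t) \<le> e"
  shows "norm ((\<Sum>i<N. g (real i / real N)) / of_nat N - integral {0..1} g) \<le> e"
proof -
  have split: "integral {0..real m / real N} g = (\<Sum>i<m. integral {real i / real N..real (Suc i) / real N} g)"
    if "m \<le> N" for m
    using that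
  proof (induction m)
    case (Suc m)
    have "g integrable_on {0..real (Suc m) / real N}"
      by (rule integrable_continuous_real, rule continuous_on_subset[OF cont])
         (use Suc.prems N in \<open>auto simp: field_simps\<close>)
    then have "integral {0..real m / real N} g + integral {real m / real N..real (Suc m) / real N} g
        = integral {0..real (Suc m) / real N} g"
      by (intro Henstock_Kurzweil_Integration.integral_combine) (auto simp: divide_right_mono)
    with Suc show ?case by (simp del: of_nat_Suc)
  qed simp
  have piece: "norm (g (real i / real N) / of_nat N - integral {real i / real N..real (Suc i) / real N} g) \<le> e / real N"
    if "i < N" for i
  proof -
    let ?I = "{real i / real N..real (Suc i) / real N}"
    have I: "?I \<subseteq> {0..1}"
      using that N by (auto simp: divide_le_eq_1 intro: order_trans[OF divide_nonneg_nonneg])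
    have ci: "continuous_on ?I g" using cont I by (rule continuous_on_subset)
    have len: "real (Suc i) / real N - real i / real N = 1 / real N" by (simp add: diff_divide_distrib[symmetric])
    have "integral ?I (\<lambda>t. g (real i / real N) - g t) = g (real i / real N) / of_nat N - integral ?I g"
    proof -
      have "integral ?I (\<lambda>t. g (real i / real N) - g t) = integral ?I (\<lambda>t. g (real i / real N)) - integral ?I g"
        by (intro Henstock_Kurzweil_Integration.integral_diff integrable_continuous_real ci continuous_on_const)
      also have "integral ?I (\<lambda>t. g (real i / real N)) = g (real i / real N) / of_nat N"
        using len by (simp add: divide_right_mono scaleR_conv_of_real)
      finally show ?thesis .
    qed
    moreover have "norm (integral ?I (\<lambda>t. g (real i / real N) - g t)) \<le> e * (real (Suc i) / real N - real i / real N)"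
    proof (rule integral_bound)
      show "real i / real N \<le> real (Suc i) / real N" by (simp add: divide_right_mono)
      show "continuous_on ?I (\<lambda>t. g (real i / real N) - g t)" by (intro continuous_intros ci)
      fix t assume t: "t \<in> ?I"
      show "norm (g (real i / real N) - g t) \<le> e"
        by (rule osc) (use t subsetD[OF I, of t] subsetD[OF I, of "real i / real N"] len in \<open>auto simp: divide_right_mono\<close>)
    qed
    ultimately show ?thesis using len by simp
  qed
  have "(\<Sum>i<N. g (real i / real N)) / of_nat N - integral {0..1} g
      = (\<Sum>i<N. g (real i / real N) / of_nat N - integral {real i / real N..real (Suc i) / real N} g)"
    using split[of N] N by (simp add: sum_subtractf sum_divide_distrib)
  also have "norm \<dots> \<le> (\<Sum>i<N. e / real N)"
    by (rule sum_norm_le) (use piece in auto)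
  also have "\<dots> = e" using N by simp
  finally show ?thesis .
qed

text \<open>Only joint continuity is required, not continuity of the derivative in the parameter: the integral
is a locally uniform limit of Riemann sums, each of which is holomorphic. This matters because
at the vertex of a sector the integrands are continuous but not smooth.\<close>

lemma holomorphic_on_integral_param:
  fixes f :: "complex \<Rightarrow> real \<Rightarrow> complex"
  assumes U: "open U" and cont: "continuous_on (U \<times> {0..1}) (\<lambda>(z, t). f z t)"
    and hol: "\<And>t. t \<in> {0..1} \<Longrightarrow> (\<lambda>z. f z t) holomorphic_on U"
  shows "(\<lambda>z. integral {0..1} (f z)) holomorphic_on U"
proof (rule holomorphic_uniform_sequence[OF U])
  let ?s = "\<lambda>n z. (\<Sum>i<Suc n. f z (real i / real (Suc n))) / of_nat (Suc n)"
  show "?s n holomorphic_on U" for n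
    by (intro holomorphic_intros hol) (auto simp: field_simps)
  fix z assume "z \<in> U"
  then obtain d where d: "d > 0" "cball z d \<subseteq> U" using U open_contains_cball by blast
  have "compact (cball z d \<times> {0..1::real})" by (intro compact_Times) auto
  moreover have c: "continuous_on (cball z d \<times> {0..1}) (\<lambda>(z, t). f z t)"
    by (rule continuous_on_subset[OF cont]) (use d in auto)
  ultimately have uc: "uniformly_continuous_on (cball z d \<times> {0..1}) (\<lambda>(z, t). f z t)"
    by (rule compact_uniformly_continuous[rotated])
  have "uniform_limit (cball z d) ?s (\<lambda>z. integral {0..1} (f z)) sequentially"
  proof (rule uniform_limitI)
    fix e :: real assume e: "e > 0"
    with uc obtain \<delta> where \<delta>: "\<delta> > 0"
      "\<And>p q. p \<in> cball z d \<times> {0..1} \<Longrightarrow> q \<in> cball z d \<times> {0..1} \<Longrightarrow> dist q p < \<delta>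
        \<Longrightarrow> dist ((\<lambda>(z, t). f z t) q) ((\<lambda>(z, t). f z t) p) < e / 2"
      unfolding uniformly_continuous_on_def by (metis half_gt_zero)
    have "\<forall>\<^sub>F n in sequentially. 1 / real (Suc n) < \<delta>"
      using LIMSEQ_inverse_real_of_nat \<delta>(1) by (auto simp: tendsto_iff inverse_eq_divide dist_norm elim: allE[of _ \<delta>])
    then show "\<forall>\<^sub>F n in sequentially. \<forall>w\<in>cball z d. dist (?s n w) (integral {0..1} (f w)) < e"
    proof eventually_elim
      case (elim n)
      show ?case
      proof
        fix w assume w: "w \<in> cball z d"
        have "norm (?s n w - integral {0..1} (f w)) \<le> e / 2"
        proof (rule riemann_sum_close)
          show "continuous_on {0..1} (f w)"
            using continuous_on_compose2[OF c, of "{0..1}" "\<lambda>t. (w, t)"] w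
            by (auto simp: image_subset_iff intro: continuous_on_Pair[OF continuous_on_const continuous_on_id])
          fix s t :: real assume st: "s \<in> {0..1}" "t \<in> {0..1}" "\<bar>s - t\<bar> \<le> 1 / real (Suc n)"
          have "dist (w, s) (w, t) < \<delta>" using st elim by (simp add: dist_Pair_Pair dist_real_def)
          then show "norm (f w s - f w t) \<le> e / 2"
            using \<delta>(2)[of "(w, t)" "(w, s)"] st w by (auto simp: dist_norm)
        qed simp
        then show "dist (?s n w) (integral {0..1} (f w)) < e" using e by (simp add: dist_norm)
      qed
    qed
  qed
  with d show "\<exists>d>0. cball z d \<subseteq> U \<and> uniform_limit (cball z d) ?s (\<lambda>z. integral {0..1} (f z)) sequentially"
    by blast
qed

section \<open>The pseudo-hyperbolic distance\<close>

lemma Moebius_denominator_nonzero: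
  assumes "norm (c::complex) < 1" "norm w < 1"
  shows "1 + cnj c * w \<noteq> 0"
proof
  assume "1 + cnj c * w = 0"
  then have "norm (cnj c * w) = 1"
    by (metis add.inverse_unique norm_minus_cancel norm_one)
  then have "norm c * norm w = 1" by (simp add: norm_mult)
  moreover have "norm c * norm w < 1 * 1" by (rule mult_strict_mono) (use assms in auto)
  ultimately show False by simp
qed

lemma Schwarz_Pick_at_0:
  assumes hol: "g holomorphic_on ball 0 1" and bd: "\<And>z. norm z < 1 \<Longrightarrow> norm (g z) < 1" and z: "norm z < 1"
  shows "norm (Moebius_function 0 (g 0) (g z)) \<le> norm z"
proof -
  have g0: "norm (g 0) < 1" by (rule bd) simp
  have "(Moebius_function 0 (g 0) \<circ> g) holomorphic_on ball 0 1"
    by (rule holomorphic_on_compose_gen[OF hol Moebius_function_holomorphic[OF g0]]) (use bd in auto)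
  from Schwarz_Lemma(1)[OF this _ _ z] show ?thesis
    using Moebius_function_norm_lt_1[OF g0 bd] by (simp add: Moebius_function_eq_zero o_def)
qed

text \<open>The inclusion of the disc of radius \<open>\<theta>\<close> into the unit disc contracts pseudo-hyperbolic distances.
With \<open>w = cnj u * v\<close> and \<open>s = \<theta>\<^sup>2\<close> the claim is \<open>(1 + s) |s - w| \<le> 2 s |1 - w|\<close> for
\<open>|w| \<le> s\<close>, where equality holds at \<open>w = - s\<close>.\<close>

lemma Moebius_small_disc:
  fixes u v :: complex
  assumes \<theta>: "0 < \<theta>" "\<theta> < 1" and u: "norm u \<le> \<theta>" and v: "norm v \<le> \<theta>"
  shows "norm (Moebius_function 0 u v) \<le> 2 * \<theta> / (1 + \<theta>\<^sup>2) * norm (Moebius_function 0 (u / of_real \<theta>) (v / of_real \<theta>))"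
proof -
  define w where "w = cnj u * v"
  define s where "s = \<theta>\<^sup>2"
  have s: "0 < s" "s < 1" using \<theta> by (auto simp: s_def power_less_one_iff)
  have wn: "norm w \<le> s" unfolding w_def s_def norm_mult power2_eq_square complex_mod_cnj
    by (rule mult_mono) (use u v \<theta> in auto)
  define m where "m = (norm w)\<^sup>2"
  have m: "m \<le> s\<^sup>2" unfolding m_def by (rule power_mono[OF wn]) simp
  have x: "Re w \<ge> -s" using wn abs_Re_le_cmod[of w] by linarith
  have n1: "(norm (of_real s - w))\<^sup>2 = s\<^sup>2 - 2 * s * Re w + m"
    unfolding m_def cmod_power2 by (simp add: power2_eq_square algebra_simps)
  have n2: "(norm (1 - w))\<^sup>2 = 1 - 2 * Re w + m"
    unfolding m_def cmod_power2 by (simp add: power2_eq_square algebra_simps)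
  have "((1 + s) * norm (of_real s - w))\<^sup>2 \<le> (2 * s * norm (1 - w))\<^sup>2"
  proof -
    have "(2 * s * norm (1 - w))\<^sup>2 - ((1 + s) * norm (of_real s - w))\<^sup>2
       = ((1 - s) * (1 + 3 * s)) * (s\<^sup>2 - m) + 2 * s * (1 - s)\<^sup>2 * (s + Re w)"
      unfolding power_mult_distrib n1 n2 by (simp add: power2_eq_square algebra_simps)
    moreover have "((1 - s) * (1 + 3 * s)) * (s\<^sup>2 - m) \<ge> 0"
      using s m by (intro mult_nonneg_nonneg) auto
    moreover have "2 * s * (1 - s)\<^sup>2 * (s + Re w) \<ge> 0"
      using s x by (intro mult_nonneg_nonneg) auto
    ultimately show ?thesis by linarith
  qed
  then have key: "(1 + s) * norm (of_real s - w) \<le> 2 * s * norm (1 - w)"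
    by (rule power2_le_imp_le) (use s in auto)
  have w1: "1 - w \<noteq> 0" using wn s by (metis eq_iff_diff_eq_0 norm_one not_less)
  have e1: "Moebius_function 0 u v = (v - u) / (1 - w)"
    by (simp add: Moebius_function_simple w_def)
  show ?thesis
  proof (cases "of_real s - w = 0 \<or> v = u")
    case True
    show ?thesis
    proof (cases "v = u")
      case False
      with True have ww: "w = of_real s" by simp
      then have "norm u * norm v = \<theta> * \<theta>" unfolding w_def s_def
        by (metis complex_mod_cnj norm_mult norm_of_real abs_of_pos s(1) s_def power2_eq_square)
      have nu: "norm u = \<theta>" and nv: "norm v = \<theta>"
      proof -
        have "norm u * norm v \<le> norm u * \<theta>" "norm u * norm v \<le> \<theta> * norm v"
          using u v by (auto intro: mult_left_mono mult_right_mono)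
        then have "\<theta> * \<theta> \<le> norm u * \<theta>" "\<theta> * \<theta> \<le> \<theta> * norm v"
          using \<open>norm u * norm v = \<theta> * \<theta>\<close> by auto
        then show "norm u = \<theta>" "norm v = \<theta>" using \<theta> u v by (auto simp: mult_le_cancel_left mult_le_cancel_right)
      qed
      have "cnj u * v = cnj u * u"
        using ww nu complex_norm_square[of u] by (simp add: w_def s_def mult.commute)
      moreover have "cnj u \<noteq> 0" using nu \<theta> by auto
      ultimately show ?thesis using False by simp
    qed (simp add: e1 Moebius_function_eq_zero)
  next
    case False
    have e2: "Moebius_function 0 (u / of_real \<theta>) (v / of_real \<theta>) = of_real \<theta> * (v - u) / (of_real s - w)"
    proof -
      have "1 - cnj (u / of_real \<theta>) * (v / of_real \<theta>) = (of_real s - w) / of_real s"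
        using \<theta> by (simp add: w_def s_def field_simps power2_eq_square)
      then show ?thesis using \<theta> False by (simp add: Moebius_function_simple s_def power2_eq_square field_simps)
    qed
    have "norm (v - u) * ((1 + s) * norm (of_real s - w)) \<le> norm (v - u) * (2 * s * norm (1 - w))"
      by (rule mult_left_mono[OF key]) simp
    then show ?thesis unfolding e1 e2 using False \<theta> w1 s
      by (simp add: norm_divide norm_mult s_def[symmetric] divide_simps)
         (simp add: s_def power2_eq_square algebra_simps)
  qed
qed

text \<open>The Earle-Hamilton contraction for a functional \<open>T\<close> on functions with values in the disc of radius
\<open>R\<close>. The discs \<open>h\<close> joining \<open>y1\<close> to \<open>y2\<close> are built with Moebius maps centred at the values of \<open>y1\<close>;
they involve \<open>cnj (y1 x)\<close> and are therefore holomorphic in \<open>\<zeta>\<close> but only continuous in \<open>x\<close>, which is why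
\<open>T\<close> is required to accept continuous functions.\<close>

lemma pseudo_hyperbolic_contraction:
  fixes y1 y2 :: "complex \<Rightarrow> complex" and T :: "(complex \<Rightarrow> complex) \<Rightarrow> complex"
  assumes R: "R > 0" and \<theta>: "0 < \<theta>" "\<theta> < 1" and \<delta>: "0 < \<delta>" "\<delta> < 1"
    and cont: "continuous_on X y1" "continuous_on X y2"
    and bd: "\<And>x. x \<in> X \<Longrightarrow> norm (y1 x) < R" "\<And>x. x \<in> X \<Longrightarrow> norm (y2 x) < R"
    and close: "\<And>x. x \<in> X \<Longrightarrow> norm (Moebius_function 0 (y1 x / of_real R) (y2 x / of_real R)) \<le> \<delta>"
    and local: "\<And>y y'. (\<And>x. x \<in> X \<Longrightarrow> y x = y' x) \<Longrightarrow> T y = T y'"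
    and hol: "\<And>h. continuous_on (ball 0 1 \<times> X) (\<lambda>(\<zeta>, x). h \<zeta> x) \<Longrightarrow>
        (\<And>x. x \<in> X \<Longrightarrow> (\<lambda>\<zeta>. h \<zeta> x) holomorphic_on ball 0 1) \<Longrightarrow>
        (\<And>\<zeta> x. \<zeta> \<in> ball 0 1 \<Longrightarrow> x \<in> X \<Longrightarrow> norm (h \<zeta> x) < R) \<Longrightarrow>
        (\<lambda>\<zeta>. T (h \<zeta>)) holomorphic_on ball 0 1 \<and> (\<forall>\<zeta>\<in>ball 0 1. norm (T (h \<zeta>)) < \<theta> * R)"
  shows "norm (Moebius_function 0 (T y1 / of_real R) (T y2 / of_real R)) \<le> 2 * \<theta> / (1 + \<theta>\<^sup>2) * \<delta>"
proof -
  define c d where "c x = y1 x / of_real R" and "d x = y2 x / of_real R" for x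
  \<comment> \<open>division by \<open>\<delta>\<close> makes the disc reach \<open>y2\<close> already at \<open>\<zeta> = \<delta>\<close>\<close>
  define q where "q x = Moebius_function 0 (c x) (d x) / of_real \<delta>" for x
  define h where "h \<zeta> x = of_real R * ((\<zeta> * q x + c x) / (1 + cnj (c x) * (\<zeta> * q x)))" for \<zeta> x
  have c1: "norm (c x) < 1" and d1: "norm (d x) < 1" and q1: "norm (q x) \<le> 1" if "x \<in> X" for x
    using bd[OF that] close[OF that] R \<delta> by (auto simp: c_def d_def q_def norm_divide)
  have cc: "continuous_on X c" "continuous_on X d"
    unfolding c_def d_def using R by (auto intro!: continuous_intros cont)
  have cq: "continuous_on X q"
    unfolding q_def Moebius_function_simple
    using Moebius_denominator_nonzero[of "- c x" "d x" for x] c1 d1 \<delta>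
    by (intro continuous_intros cc) force+
  have zq: "norm (\<zeta> * q x) < 1" if "\<zeta> \<in> ball 0 1" "x \<in> X" for \<zeta> x
    using that q1[of x] mult_right_mono[of "norm (q x)" 1 "norm \<zeta>"]
    by (auto simp: norm_mult mult.commute)
  have nz: "1 + cnj (c x) * (\<zeta> * q x) \<noteq> 0" if "\<zeta> \<in> ball 0 1" "x \<in> X" for \<zeta> x
    by (rule Moebius_denominator_nonzero) (use that c1 zq in auto)
  have hM: "h \<zeta> x = of_real R * Moebius_function 0 (- c x) (\<zeta> * q x)" for \<zeta> x
    by (simp add: h_def Moebius_function_simple)
  have h0: "h 0 x = y1 x" for x using R by (simp add: h_def c_def)
  have h1: "h (of_real \<delta>) x = y2 x" if "x \<in> X" for x
  proof -
    have "h (of_real \<delta>) x = of_real R * Moebius_function 0 (- c x) (Moebius_function 0 (c x) (d x))"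
      using \<delta> by (simp add: hM q_def)
    also have "Moebius_function 0 (- c x) (Moebius_function 0 (c x) (d x)) = d x"
      by (rule Moebius_function_compose) (use c1 d1 that in auto)
    finally show ?thesis using R by (simp add: d_def)
  qed
  have "(\<lambda>\<zeta>. T (h \<zeta>)) holomorphic_on ball 0 1 \<and> (\<forall>\<zeta>\<in>ball 0 1. norm (T (h \<zeta>)) < \<theta> * R)"
  proof (rule hol)
    have cont_snd: "continuous_on (ball (0::complex) 1 \<times> X) (\<lambda>p. f (snd p))" if "continuous_on X f" for f :: "complex \<Rightarrow> complex"
      by (rule continuous_on_compose2[OF that]) (auto intro!: continuous_intros)
    show "continuous_on (ball 0 1 \<times> X) (\<lambda>(\<zeta>, x). h \<zeta> x)"
      unfolding h_def case_prod_unfold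
      by (intro continuous_intros cont_snd cc cq) (use nz in auto)
    show "(\<lambda>\<zeta>. h \<zeta> x) holomorphic_on ball 0 1" if "x \<in> X" for x
      unfolding h_def by (intro holomorphic_intros) (use nz that in auto)
    show "norm (h \<zeta> x) < R" if "\<zeta> \<in> ball 0 1" "x \<in> X" for \<zeta> x
      using Moebius_function_norm_lt_1[of "- c x" "\<zeta> * q x" 0] c1 zq that R by (auto simp: hM norm_mult)
  qed
  then have Th: "(\<lambda>\<zeta>. T (h \<zeta>)) holomorphic_on ball 0 1" "\<And>\<zeta>. norm \<zeta> < 1 \<Longrightarrow> norm (T (h \<zeta>)) < \<theta> * R" by auto
  define g where "g \<zeta> = T (h \<zeta>) / of_real (\<theta> * R)" for \<zeta>
  have "norm (Moebius_function 0 (g 0) (g (of_real \<delta>))) \<le> norm (complex_of_real \<delta>)"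
  proof (rule Schwarz_Pick_at_0)
    show "g holomorphic_on ball 0 1" unfolding g_def by (intro holomorphic_intros Th) (use R \<theta> in auto)
    show "norm (g z) < 1" if "norm z < 1" for z
      using Th(2)[OF that] R \<theta> by (simp add: g_def norm_divide norm_mult)
  qed (use \<delta> in auto)
  moreover have "T (h 0) = T y1" "T (h (of_real \<delta>)) = T y2" by (auto intro!: local simp: h0 h1)
  ultimately have *: "norm (Moebius_function 0 (T y1 / of_real R / of_real \<theta>) (T y2 / of_real R / of_real \<theta>)) \<le> \<delta>"
    using \<delta> by (simp add: g_def mult.commute)
  have "norm (T y1 / of_real R) \<le> \<theta>" "norm (T y2 / of_real R) \<le> \<theta>"
    using Th(2)[of 0] Th(2)[of "of_real \<delta>"] \<delta> R \<open>T (h 0) = T y1\<close> \<open>T (h (of_real \<delta>)) = T y2\<close>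
    by (auto simp: norm_divide field_simps)
  from Moebius_small_disc[OF \<theta> this] show ?thesis
    by (rule order_trans, intro mult_left_mono *) (use \<theta> in auto)
qed

text \<open>The pseudo-hyperbolic distance dominates the Euclidean one up to the factor 2, since \<open>|1 - cnj c * d| \<le> 2\<close> in
the unit disc.\<close>

lemma norm_diff_le_Moebius:
  assumes u: "norm u < R" and v: "norm v < R" and le: "norm (Moebius_function 0 (u / of_real R) (v / of_real R)) \<le> e"
  shows "norm (v - u) \<le> 2 * R * e"
proof -
  have R: "R > 0" using u norm_ge_zero[of u] by linarith
  define c d where "c = u / of_real R" and "d = v / of_real R"
  have cd: "norm c < 1" "norm d < 1" using u v R by (auto simp: c_def d_def norm_divide)
  have "1 - cnj c * d \<noteq> 0" using Moebius_denominator_nonzero[of "- c" d] cd by auto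
  then have "d - c = Moebius_function 0 c d * (1 - cnj c * d)" by (simp add: Moebius_function_simple)
  then have "norm (d - c) = norm (Moebius_function 0 c d) * norm (1 - cnj c * d)" by (simp add: norm_mult)
  also have "\<dots> \<le> e * 2"
  proof (rule mult_mono)
    have "norm (1 - cnj c * d) \<le> norm (1::complex) + norm (cnj c * d)" by (rule norm_triangle_ineq4)
    moreover have "norm (cnj c * d) \<le> 1 * 1" unfolding norm_mult by (rule mult_mono) (use cd in auto)
    ultimately show "norm (1 - cnj c * d) \<le> 2" by simp
    show "norm (Moebius_function 0 c d) \<le> e" using le by (simp add: c_def d_def)
    then show "0 \<le> e" by (rule order_trans[OF norm_ge_zero])
  qed auto
  finally have "norm (d - c) \<le> e * 2" .
  moreover have "v - u = of_real R * (d - c)" using R by (simp add: c_def d_def field_simps)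
  ultimately show ?thesis using R by (simp add: norm_mult mult.commute mult.left_commute)
qed

section \<open>Fractional integrals and the Caputo derivative\<close>

text \<open>The kernel vanishes on the left half-line, so that Riemann-Liouville integrals become convolutions on
the whole line and Fubini's theorem applies without moving limits of integration.\<close>

definition frac_kernel :: "real \<Rightarrow> real \<Rightarrow> real" where
  "frac_kernel \<gamma> x = (if x > 0 then x powr (\<gamma> - 1) / Gamma \<gamma> else 0)"

definition frac_int :: "real \<Rightarrow> (real \<Rightarrow> complex) \<Rightarrow> real \<Rightarrow> complex" where
  "frac_int \<gamma> P t = (\<integral>s. frac_kernel \<gamma> (t - s) *\<^sub>R P s \<partial>lborel)"

lemma frac_kernel_measurable [measurable]: "frac_kernel \<gamma> \<in> borel_measurable borel"
  unfolding frac_kernel_def by measurable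

lemma frac_kernel_nonneg: "\<gamma> > 0 \<Longrightarrow> frac_kernel \<gamma> x \<ge> 0"
  by (simp add: frac_kernel_def Gamma_real_pos less_imp_le)

text \<open>After scaling the segment from \<open>s\<close> to \<open>t\<close> to the unit interval this is Euler's Beta integral.\<close>

lemma frac_kernel_convolution:
  assumes "\<beta> > 0" "\<gamma> > 0"
  shows "(\<integral>\<^sup>+ r. ennreal (frac_kernel \<beta> (t - r) * frac_kernel \<gamma> (r - s)) \<partial>lborel)
    = ennreal (frac_kernel (\<beta> + \<gamma>) (t - s))"
proof (cases "s < t")
  case False
  then have "frac_kernel \<beta> (t - r) * frac_kernel \<gamma> (r - s) = 0" for r
    by (auto simp: frac_kernel_def)
  then have "(\<integral>\<^sup>+ r. ennreal (frac_kernel \<beta> (t - r) * frac_kernel \<gamma> (r - s)) \<partial>lborel) = 0"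
    by (simp only: ennreal_0 nn_integral_const) simp
  then show ?thesis using False by (simp add: frac_kernel_def)
next
  case True
  define d where "d = t - s"
  have d: "d > 0" using True by (simp add: d_def)
  define K where "K = d powr (\<beta> + \<gamma> - 2) / (Gamma \<beta> * Gamma \<gamma>)"
  have G: "Gamma \<beta> > 0" "Gamma \<gamma> > 0" "Gamma (\<beta> + \<gamma>) > 0" using assms by (auto intro!: Gamma_real_pos)
  have K: "K \<ge> 0" using G by (simp add: K_def)
  have ker: "frac_kernel \<beta> (t - (s + d * x)) * frac_kernel \<gamma> ((s + d * x) - s)
     = K * (indicator {0<..<1} x * (x powr (\<gamma> - 1) * (1 - x) powr (\<beta> - 1)))" for x
  proof (cases "0 < x \<and> x < 1")
    case x: True
    have e: "t - (s + d * x) = d * (1 - x)" by (simp add: d_def algebra_simps)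
    have "d powr (\<beta> - 1) * d powr (\<gamma> - 1) = d powr (\<beta> + \<gamma> - 2)"
      by (simp add: powr_add[symmetric])
    then show ?thesis unfolding e K_def using x d
      by (simp add: frac_kernel_def powr_mult flip: \<open>d powr (\<beta> - 1) * d powr (\<gamma> - 1) = _\<close>)
  next
    case False
    have e: "t - (s + d * x) = d * (1 - x)" by (simp add: d_def algebra_simps)
    show ?thesis unfolding e using False d
      by (auto simp: frac_kernel_def zero_less_mult_iff)
  qed
  have "(\<integral>\<^sup>+ r. ennreal (frac_kernel \<beta> (t - r) * frac_kernel \<gamma> (r - s)) \<partial>lborel)
     = ennreal \<bar>d\<bar> * (\<integral>\<^sup>+ x. ennreal (frac_kernel \<beta> (t - (s + d * x)) * frac_kernel \<gamma> ((s + d * x) - s)) \<partial>lborel)"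
    by (rule nn_integral_real_affine) (use d in auto)
  also have "(\<integral>\<^sup>+ x. ennreal (frac_kernel \<beta> (t - (s + d * x)) * frac_kernel \<gamma> ((s + d * x) - s)) \<partial>lborel)
     = (\<integral>\<^sup>+ x. ennreal K * ennreal (indicator {0<..<1} x * (x powr (\<gamma> - 1) * (1 - x) powr (\<beta> - 1))) \<partial>lborel)"
    unfolding ker using K by (simp add: ennreal_mult')
  also have "\<dots> = ennreal K * (\<integral>\<^sup>+ x. ennreal (indicator {0<..<1} x * (x powr (\<gamma> - 1) * (1 - x) powr (\<beta> - 1))) \<partial>lborel)"
    by (rule nn_integral_cmult) measurable
  also have "(\<integral>\<^sup>+ x. ennreal (indicator {0<..<1} x * (x powr (\<gamma> - 1) * (1 - x) powr (\<beta> - 1))) \<partial>lborel) = ennreal (Beta \<gamma> \<beta>)"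
    using assms
    by (intro nn_integral_has_integral_lebesgue)
       (auto simp flip: has_integral_Icc_iff_Ioo intro: has_integral_Beta_real)
  also have "ennreal \<bar>d\<bar> * (ennreal K * ennreal (Beta \<gamma> \<beta>)) = ennreal (d * (K * Beta \<gamma> \<beta>))"
    using d K by (simp add: ennreal_mult')
  also have "d * (K * Beta \<gamma> \<beta>) = d powr (\<beta> + \<gamma> - 1) / Gamma (\<beta> + \<gamma>)"
  proof -
    have "d * d powr (\<beta> + \<gamma> - 2) = d powr (\<beta> + \<gamma> - 1)"
      using d powr_mult_base[of d "\<beta> + \<gamma> - 2"] by (simp add: algebra_simps)
    then show ?thesis using G by (simp add: K_def Beta_def add.commute field_simps)
  qed
  finally show ?thesis using d by (simp add: frac_kernel_def d_def)
qed

lemma frac_kernel_pairing_finite: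
  assumes "\<gamma> > 0"
  shows "(\<integral>\<^sup>+ s. ennreal (frac_kernel \<gamma> (t - s) * (if q < s then 1 else 0)) \<partial>lborel) < \<infinity>"
proof -
  have "frac_kernel 1 (s - q) = (if q < s then 1 else 0)" for s by (simp add: frac_kernel_def)
  then show ?thesis using frac_kernel_convolution[of \<gamma> 1 t q] assms by simp
qed

text \<open>Densities that vanish up to the base point \<open>q\<close>: on them the convolution with \<open>frac_kernel\<close> is the
Riemann-Liouville integral with lower limit \<open>q\<close>.\<close>

locale bounded_history =
  fixes P :: "real \<Rightarrow> complex" and q C :: real
  assumes meas [measurable]: "P \<in> borel_measurable borel"
    and zero: "\<And>s. s \<le> q \<Longrightarrow> P s = 0"
    and bound: "\<And>s. norm (P s) \<le> C"
begin

lemma C_nonneg: "C \<ge> 0" using bound[of 0] norm_ge_zero order_trans by blast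

lemma bound': "norm (P s) \<le> C * (if q < s then 1 else 0)"
  using bound[of s] zero[of s] by auto

lemma integrable_frac_kernel:
  assumes g: "\<gamma> > 0"
  shows "integrable lborel (\<lambda>s. frac_kernel \<gamma> (t - s) *\<^sub>R P s)"
proof (rule integrableI_bounded)
  have "(\<integral>\<^sup>+ s. ennreal (norm (frac_kernel \<gamma> (t - s) *\<^sub>R P s)) \<partial>lborel)
     \<le> (\<integral>\<^sup>+ s. ennreal C * ennreal (frac_kernel \<gamma> (t - s) * (if q < s then 1 else 0)) \<partial>lborel)"
  proof (intro nn_integral_mono)
    fix s
    show "ennreal (norm (frac_kernel \<gamma> (t - s) *\<^sub>R P s))
        \<le> ennreal C * ennreal (frac_kernel \<gamma> (t - s) * (if q < s then 1 else 0))"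
      using frac_kernel_nonneg[OF g] C_nonneg mult_left_mono[OF bound'[of s] frac_kernel_nonneg[OF g, of "t - s"]]
      by (subst ennreal_mult'[symmetric]) (auto intro!: ennreal_leI simp: ac_simps)
  qed
  also have "\<dots> = ennreal C * (\<integral>\<^sup>+ s. ennreal (frac_kernel \<gamma> (t - s) * (if q < s then 1 else 0)) \<partial>lborel)"
    by (rule nn_integral_cmult) measurable
  also have "\<dots> < \<infinity>" using frac_kernel_pairing_finite[OF g, of t q] by (simp add: ennreal_mult_less_top)
  finally show "(\<integral>\<^sup>+ s. ennreal (norm (frac_kernel \<gamma> (t - s) *\<^sub>R P s)) \<partial>lborel) < \<infinity>" .
qed measurable

lemma frac_int_measurable [measurable]: "frac_int \<gamma> P \<in> borel_measurable borel"
proof -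
  have "(\<lambda>t. \<integral>s. frac_kernel \<gamma> (t - s) *\<^sub>R P s \<partial>lborel) \<in> borel_measurable lborel"
    by (rule lborel.borel_measurable_lebesgue_integral) measurable
  then show ?thesis by (simp add: frac_int_def[abs_def])
qed

lemma frac_int_semigroup:
  assumes b: "\<beta> > 0" and g: "\<gamma> > 0"
  shows "frac_int \<beta> (frac_int \<gamma> P) t = frac_int (\<beta> + \<gamma>) P t"
proof -
  let ?f = "\<lambda>s r. (frac_kernel \<beta> (t - r) * frac_kernel \<gamma> (r - s)) *\<^sub>R P s"
  have nn: "frac_kernel \<beta> (t - r) * frac_kernel \<gamma> (r - s) \<ge> 0" for r s
    using frac_kernel_nonneg[OF b] frac_kernel_nonneg[OF g] by simp
  have inner: "integrable lborel (\<lambda>r. frac_kernel \<beta> (t - r) * frac_kernel \<gamma> (r - s))"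
    "(\<integral>r. frac_kernel \<beta> (t - r) * frac_kernel \<gamma> (r - s) \<partial>lborel) = frac_kernel (\<beta> + \<gamma>) (t - s)" for s
  proof -
    have "has_bochner_integral lborel (\<lambda>r. frac_kernel \<beta> (t - r) * frac_kernel \<gamma> (r - s)) (frac_kernel (\<beta> + \<gamma>) (t - s))"
      by (rule has_bochner_integral_nn_integral)
         (use nn frac_kernel_convolution[OF b g, of t s] frac_kernel_nonneg[of "\<beta> + \<gamma>" "t - s"] b g in auto)
    then show "integrable lborel (\<lambda>r. frac_kernel \<beta> (t - r) * frac_kernel \<gamma> (r - s))"
      "(\<integral>r. frac_kernel \<beta> (t - r) * frac_kernel \<gamma> (r - s) \<partial>lborel) = frac_kernel (\<beta> + \<gamma>) (t - s)"
      by (auto simp: has_bochner_integral_iff)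
  qed
  have int: "integrable (lborel \<Otimes>\<^sub>M lborel) (\<lambda>(s, r). ?f s r)"
  proof (rule lborel_pair.Fubini_integrable)
    show "(\<lambda>(s, r). ?f s r) \<in> borel_measurable (lborel \<Otimes>\<^sub>M lborel)" by measurable
    have "(\<integral>r. norm (?f s r) \<partial>lborel) = norm (frac_kernel (\<beta> + \<gamma>) (t - s) *\<^sub>R P s)" for s
    proof -
      have "norm (?f s r) = (frac_kernel \<beta> (t - r) * frac_kernel \<gamma> (r - s)) * norm (P s)" for r
        unfolding norm_scaleR abs_of_nonneg[OF nn] ..
      then show ?thesis using inner(2)[of s] frac_kernel_nonneg[of "\<beta> + \<gamma>" "t - s"] b g
        by (simp only: integral_mult_left_zero norm_scaleR abs_of_nonneg)
    qed
    then show "integrable lborel (\<lambda>s. \<integral>r. norm (case (s, r) of (s, r) \<Rightarrow> ?f s r) \<partial>lborel)"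
      using integrable_norm[OF integrable_frac_kernel[of "\<beta> + \<gamma>" t]] b g by (simp only: prod.case)
    show "AE s in lborel. integrable lborel (\<lambda>r. case (s, r) of (s, r) \<Rightarrow> ?f s r)"
      using inner(1) by (auto intro!: AE_I2 integrable_scaleR_left)
  qed
  have "frac_int \<beta> (frac_int \<gamma> P) t = (\<integral>r. (\<integral>s. ?f s r \<partial>lborel) \<partial>lborel)"
    unfolding frac_int_def by (simp flip: integral_scaleR_right add: mult.assoc)
  also have "\<dots> = (\<integral>s. (\<integral>r. ?f s r \<partial>lborel) \<partial>lborel)"
    using lborel_pair.Fubini_integral[OF int] by simp
  also have "\<dots> = frac_int (\<beta> + \<gamma>) P t"
    using inner by (simp add: frac_int_def)
  finally show ?thesis .
qed

text \<open>Moving the argument into \<open>P\<close> leaves the singularity of the kernel fixed, so that dominated convergence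
applies; the jump of \<open>P\<close> at \<open>q\<close> is seen at a single point of the domain of integration.\<close>

lemma continuous_on_frac_int:
  assumes g: "\<gamma> > 0" and cont: "continuous_on {q<..q2} P"
  shows "continuous_on {q..q2} (frac_int \<gamma> P)"
  unfolding continuous_on_sequentially
proof (intro ballI allI impI, elim conjE)
  fix t and T :: "nat \<Rightarrow> real"
  assume t: "t \<in> {q..q2}" and T: "\<forall>n. T n \<in> {q..q2}" "T \<longlonglongrightarrow> t"
  have shift: "frac_int \<gamma> P r = (\<integral>v. frac_kernel \<gamma> v *\<^sub>R P (r - v) \<partial>lborel)" for r
    unfolding frac_int_def
    using lborel_integral_real_affine[of "-1" "\<lambda>s. frac_kernel \<gamma> (r - s) *\<^sub>R P s" r] by simp
  have "(\<lambda>n. \<integral>v. frac_kernel \<gamma> v *\<^sub>R P (T n - v) \<partial>lborel) \<longlonglongrightarrow> (\<integral>v. frac_kernel \<gamma> v *\<^sub>R P (t - v) \<partial>lborel)"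
  proof (rule integral_dominated_convergence[where w = "\<lambda>v. C * (frac_kernel \<gamma> (q2 - (q2 - v)) * (if q < q2 - v then 1 else 0))"])
    have "integrable lborel (\<lambda>s. frac_kernel \<gamma> (q2 - s) * (if q < s then 1 else 0))"
      using frac_kernel_pairing_finite[OF g, of q2 q] frac_kernel_nonneg[OF g]
      by (intro integrableI_nonneg) auto
    from lborel_integrable_real_affine[OF this, of "-1" q2]
    show "integrable lborel (\<lambda>v. C * (frac_kernel \<gamma> (q2 - (q2 - v)) * (if q < q2 - v then 1 else 0)))"
      by simp
    show "AE v in lborel. norm (frac_kernel \<gamma> v *\<^sub>R P (T n - v))
        \<le> C * (frac_kernel \<gamma> (q2 - (q2 - v)) * (if q < q2 - v then 1 else 0))" for n
    proof (intro AE_I2)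
      fix v
      have "norm (P (T n - v)) \<le> C * (if q < q2 - v then 1 else 0)"
        using bound'[of "T n - v"] spec[OF T(1), of n] C_nonneg by (auto split: if_splits)
      then show "norm (frac_kernel \<gamma> v *\<^sub>R P (T n - v))
        \<le> C * (frac_kernel \<gamma> (q2 - (q2 - v)) * (if q < q2 - v then 1 else 0))"
        using mult_left_mono[OF _ frac_kernel_nonneg[OF g, of v]] frac_kernel_nonneg[OF g, of v]
        by (fastforce simp: ac_simps)
    qed
    have "AE v in lborel. v \<noteq> t - q" by (rule AE_lborel_singleton)
    then show "AE v in lborel. (\<lambda>n. frac_kernel \<gamma> v *\<^sub>R P (T n - v)) \<longlonglongrightarrow> frac_kernel \<gamma> v *\<^sub>R P (t - v)"
    proof eventually_elim
      case (elim v)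
      have lim: "(\<lambda>n. T n - v) \<longlonglongrightarrow> t - v" by (intro tendsto_intros T)
      consider "v \<le> 0" | "v > 0" "t - v > q" | "v > 0" "t - v < q" using elim by linarith
      then show ?case
      proof cases
        case 1 then show ?thesis by (simp add: frac_kernel_def)
      next
        case 2
        have "\<forall>\<^sub>F n in sequentially. T n - v \<in> {q<..q2}"
          using order_tendstoD(1)[OF lim 2(2)]
          proof eventually_elim
            case (elim n)
            then show ?case using 2 spec[OF T(1), of n] by auto
          qed
        then have "(\<lambda>n. P (T n - v)) \<longlonglongrightarrow> P (t - v)"
          by (intro continuous_on_tendsto_compose[OF cont lim]) (use 2 t in auto)
        then show ?thesis by (intro tendsto_intros)
      next
        case 3
        have "\<forall>\<^sub>F n in sequentially. P (T n - v) = P (t - v)"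
          using order_tendstoD(2)[OF lim 3(2)] by eventually_elim (use 3 in \<open>simp add: zero\<close>)
        then have "(\<lambda>n. P (T n - v)) \<longlonglongrightarrow> P (t - v)" by (rule tendsto_eventually)
        then show ?thesis by (intro tendsto_intros)
      qed
    qed
  qed measurable
  then show "(frac_int \<gamma> P \<circ> T) \<longlonglongrightarrow> frac_int \<gamma> P t" by (simp add: shift o_def)
qed

end

lemma frac_int_cong:
  assumes "\<And>s. s < t \<Longrightarrow> P s = Q s"
  shows "frac_int \<gamma> P t = frac_int \<gamma> Q t"
  unfolding frac_int_def
  by (rule Bochner_Integration.integral_cong) (auto simp: frac_kernel_def assms)

lemma frac_int_eqI:
  assumes int: "integrable lborel (\<lambda>s. frac_kernel \<gamma> (t - s) *\<^sub>R P s)" and zero: "\<And>s. s \<le> q \<Longrightarrow> P s = 0"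
    and hk: "(f has_integral I) {q..t}"
    and eq: "\<And>s. q < s \<Longrightarrow> s < t \<Longrightarrow> f s = frac_kernel \<gamma> (t - s) *\<^sub>R P s"
  shows "frac_int \<gamma> P t = I"
proof -
  have "((\<lambda>s. frac_kernel \<gamma> (t - s) *\<^sub>R P s) has_integral frac_int \<gamma> P t) UNIV"
    unfolding frac_int_def by (rule has_integral_integral_lborel[OF int])
  moreover have "((\<lambda>s. frac_kernel \<gamma> (t - s) *\<^sub>R P s) has_integral I) UNIV"
  proof (rule has_integral_on_superset)
    show "((\<lambda>s. frac_kernel \<gamma> (t - s) *\<^sub>R P s) has_integral I) {q..t}"
      by (rule has_integral_spike_finite[OF _ _ hk, of "{q, t}"]) (auto simp: eq)
  qed (auto simp: frac_kernel_def zero not_le)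
  ultimately show ?thesis by (rule has_integral_unique)
qed

lemma frac_int_1_eq_integral:
  assumes "bounded_history P q C"  "(P has_integral I) {q..t}" "q \<le> t"
  shows "frac_int 1 P t = I"
  by (rule frac_int_eqI[OF bounded_history.integrable_frac_kernel[OF assms(1)] bounded_history.zero[OF assms(1)] assms(2)])
     (auto simp: frac_kernel_def)


text \<open>The substitution \<open>\<tau> = ((t - s) / (t - q))^\<alpha>\<close> absorbs the singular kernel. The left-hand side is the
integral of a continuous function over a fixed interval, and makes sense for complex \<open>t\<close>.\<close>

lemma scaled_integral_eq_frac_int:
  fixes F :: "real \<Rightarrow> complex"
  assumes \<alpha>: "\<alpha> > 0" and F: "bounded_history F0 q C" and cont: "continuous_on {q..t} F" and "q \<le> t"
    and F0: "\<And>s. q < s \<Longrightarrow> s < t \<Longrightarrow> F0 s = F s"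
  shows "of_real ((t - q) powr \<alpha> / Gamma (\<alpha> + 1)) *
      integral {0..1} (\<lambda>\<tau>. F (q + (1 - \<tau> powr (1 / \<alpha>)) * (t - q))) = frac_int \<alpha> F0 t"
proof (cases "q = t")
  case True
  have "frac_int \<alpha> F0 t = 0"
    by (rule frac_int_eqI[OF bounded_history.integrable_frac_kernel[OF F \<alpha>] bounded_history.zero[OF F],
         where f = "\<lambda>_. 0"]) (auto simp: True)
  then show ?thesis using True by simp
next
  case False
  with \<open>q \<le> t\<close> have qt: "q < t" by simp
  let ?f = "\<lambda>\<tau>. F (q + (1 - \<tau> powr (1 / \<alpha>)) * (t - q))"
  let ?g = "\<lambda>s. ((t - s) / (t - q)) powr \<alpha>"
  let ?g' = "\<lambda>s. - (\<alpha> * (t - s) powr (\<alpha> - 1) / (t - q) powr \<alpha>)"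
  have rng: "0 \<le> (1 - \<tau> powr (1 / \<alpha>)) * (t - q) \<and> (1 - \<tau> powr (1 / \<alpha>)) * (t - q) \<le> t - q"
    if "\<tau> \<in> {0..1}" for \<tau>
    using that qt \<alpha> powr_le1[of "1 / \<alpha>" \<tau>] by (auto simp: mult_le_cancel_right1 intro!: mult_nonneg_nonneg)
  have "((\<lambda>s. ?g' s *\<^sub>R ?f (?g s)) has_integral (integral {?g q..?g t} ?f - integral {?g t..?g q} ?f)) {q..t}"
  proof (rule has_integral_substitution_general[of "{t}"])
    show "?g ` {q..t} \<subseteq> {0..1}" using qt \<alpha> by (auto intro!: powr_le1 simp: divide_le_eq_1)
    show "continuous_on {0..1} ?f"
    proof (rule continuous_on_compose2[OF cont])
      show "continuous_on {0..1} (\<lambda>\<tau>. q + (1 - \<tau> powr (1 / \<alpha>)) * (t - q))"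
        using \<alpha> by (intro continuous_intros continuous_on_powr') auto
      show "(\<lambda>\<tau>. q + (1 - \<tau> powr (1 / \<alpha>)) * (t - q)) ` {0..1} \<subseteq> {q..t}" using rng by force
    qed
    show "continuous_on {q..t} ?g"
      using qt \<alpha> by (intro continuous_on_powr' continuous_intros) auto
    show "(?g has_field_derivative ?g' x) (at x within {q..t})" if "x \<in> {q..t} - {t}" for x
    proof -
      have "(?g has_field_derivative \<alpha> * ((t - x) / (t - q)) powr (\<alpha> - 1) * (- 1 / (t - q))) (at x within {q..t})"
      proof -
        have "((\<lambda>x. (t - x) / (t - q)) has_field_derivative - 1 / (t - q)) (at x within {q..t})"
          by (intro DERIV_cdivide) (auto intro!: derivative_eq_intros)
        moreover have "((\<lambda>y. y powr \<alpha>) has_field_derivative \<alpha> * ((t - x) / (t - q)) powr (\<alpha> - 1)) (at ((t - x) / (t - q)))"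
          by (rule has_real_derivative_powr) (use that qt in auto)
        ultimately show ?thesis by (rule DERIV_chain2[rotated])
      qed
      moreover have "\<alpha> * ((t - x) / (t - q)) powr (\<alpha> - 1) * (- 1 / (t - q)) = ?g' x"
        using that qt powr_mult_base[of "t - q" "\<alpha> - 1"] by (simp add: powr_divide mult.commute)
      ultimately show ?thesis by simp
    qed
  qed (use qt in auto)
  moreover have "?g q = 1" "?g t = 0" using qt by auto
  ultimately have "((\<lambda>s. ?g' s *\<^sub>R ?f (?g s)) has_integral - integral {0..1} ?f) {q..t}" by simp
  \<comment> \<open>the substitution reverses the orientation, hence the sign\<close>
  from has_integral_cmul[OF this, of "- ((t - q) powr \<alpha> / (\<alpha> * Gamma \<alpha>))"]
  have "((\<lambda>s. (- ((t - q) powr \<alpha> / (\<alpha> * Gamma \<alpha>))) *\<^sub>R ?g' s *\<^sub>R ?f (?g s)) has_integral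
      (- ((t - q) powr \<alpha> / (\<alpha> * Gamma \<alpha>))) *\<^sub>R (- integral {0..1} ?f)) {q..t}" .
  then have "frac_int \<alpha> F0 t = (- ((t - q) powr \<alpha> / (\<alpha> * Gamma \<alpha>))) *\<^sub>R (- integral {0..1} ?f)"
  proof (rule frac_int_eqI[OF bounded_history.integrable_frac_kernel[OF F \<alpha>] bounded_history.zero[OF F], rotated 1])
    fix s assume s: "q < s" "s < t"
    have "(((t - s) / (t - q)) powr \<alpha>) powr (1 / \<alpha>) = (t - s) / (t - q)"
      using s \<alpha> by (simp add: powr_powr)
    then have "q + (1 - ?g s powr (1 / \<alpha>)) * (t - q) = s" using qt by (simp add: field_simps)
    then have "?f (?g s) = F0 s" using F0 s by simp
    moreover have "(- ((t - q) powr \<alpha> / (\<alpha> * Gamma \<alpha>))) * ?g' s = frac_kernel \<alpha> (t - s)"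
      using s \<alpha> qt by (simp add: frac_kernel_def)
    ultimately show "(- ((t - q) powr \<alpha> / (\<alpha> * Gamma \<alpha>))) *\<^sub>R ?g' s *\<^sub>R ?f (?g s) = frac_kernel \<alpha> (t - s) *\<^sub>R F0 s"
      by (simp only: scaleR_scaleR)
  qed
  then show ?thesis using Gamma_plus1[of \<alpha>] \<alpha>
    by (simp add: scaleR_conv_of_real nonpos_Ints_def)
qed

text \<open>From \<open>F = I\<^sup>1 P\<close> and the semigroup law, \<open>I\<^sup>\<alpha> F = I\<^sup>1 (I\<^sup>\<alpha> P)\<close> with \<open>I\<^sup>\<alpha> P\<close> continuous, so that \<open>u' = I\<^sup>\<alpha> P\<close> up to
the end points; and the Caputo derivative of \<open>u\<close> is \<open>I\<^sup>(1-\<alpha>) (I\<^sup>\<alpha> P) = I\<^sup>1 P = F\<close>.\<close>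

lemma caputo_fractional_integral:
  fixes F P u :: "real \<Rightarrow> complex"
  assumes \<alpha>: "0 < \<alpha>" "\<alpha> < 1" and q: "q1 < q2"
    and contF: "continuous_on {q1..q2} F" and F0: "F q1 = 0"
    and deriv: "\<And>t. t \<in> {q1<..<q2} \<Longrightarrow> (F has_vector_derivative P t) (at t)"
    and contP: "continuous_on {q1<..q2} P" and bdP: "\<And>t. t \<in> {q1<..q2} \<Longrightarrow> norm (P t) \<le> C"
    and u: "\<And>t. t \<in> {q1..q2} \<Longrightarrow> u t = c + of_real ((t - q1) powr \<alpha> / Gamma (\<alpha> + 1)) *
      integral {0..1} (\<lambda>\<tau>. F (q1 + (1 - \<tau> powr (1 / \<alpha>)) * (t - q1)))"
  shows "\<exists>g. continuous_on {q1..q2} g \<and>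
      (\<forall>t\<in>{q1..q2}. (u has_vector_derivative g t) (at t within {q1..q2}) \<and> caputo q1 \<alpha> u t = F t)"
proof -
  define P0 where "P0 s = (if s \<in> {q1<..q2} then P s else 0)" for s
  define F0 where "F0 s = (if s \<in> {q1..q2} then F s else 0)" for s
  have "compact (F ` {q1..q2})" using contF by (intro compact_continuous_image) auto
  then obtain C' where C': "\<And>t. t \<in> {q1..q2} \<Longrightarrow> norm (F t) \<le> C'"
    using compact_imp_bounded bounded_iff by (metis image_eqI)
  have C0: "C \<ge> 0" using bdP[of q2] q norm_ge_zero[of "P q2"] by (meson greaterThanAtMost_iff order_refl order_trans)
  have C'0: "C' \<ge> 0" using C'[of q2] q norm_ge_zero[of "F q2"] by (meson atLeastAtMost_iff less_imp_le order_refl order_trans)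
  interpret P: bounded_history P0 q1 C
  proof
    have "set_borel_measurable borel {q1<..q2} P"
      by (rule set_measurable_continuous_on[OF _ contP]) simp
    moreover have "P0 = (\<lambda>s. indicator {q1<..q2} s *\<^sub>R P s)" by (auto simp: P0_def indicator_def)
    ultimately show "P0 \<in> borel_measurable borel" by (simp add: set_borel_measurable_def)
  qed (auto simp: P0_def bdP C0)
  interpret F: bounded_history F0 q1 C'
  proof
    have "set_borel_measurable borel {q1..q2} F"
      by (rule set_measurable_continuous_on[OF _ contF]) simp
    moreover have "F0 = (\<lambda>s. indicator {q1..q2} s *\<^sub>R F s)" by (auto simp: F0_def indicator_def)
    ultimately show "F0 \<in> borel_measurable borel" by (simp add: set_borel_measurable_def)
  qed (use \<open>F q1 = 0\<close> C' C'0 in \<open>auto simp: F0_def dest: antisym\<close>)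
  have FP: "F t = frac_int 1 P0 t" if t: "t \<in> {q1..q2}" for t
  proof -
    have "(P has_integral F t - F q1) {q1..t}"
      by (rule fundamental_theorem_of_calculus_interior)
         (use t in \<open>auto intro: deriv continuous_on_subset[OF contF]\<close>)
    then have "(P0 has_integral F t) {q1..t}"
      using t by (intro has_integral_spike_finite[of "{q1}" _ P0 P]) (auto simp: P0_def \<open>F q1 = 0\<close>)
    then show ?thesis using frac_int_1_eq_integral[OF P.bounded_history_axioms] t by auto
  qed
  define g where "g = frac_int \<alpha> P0"
  have "continuous_on {q1<..q2} P0" using contP by (rule continuous_on_eq) (simp add: P0_def)
  then have contg: "continuous_on {q1..q2} g" unfolding g_def by (rule P.continuous_on_frac_int[OF \<alpha>(1)])
  define g0 where "g0 s = (if s \<in> {q1..q2} then g s else 0)" for s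
  have "compact (g ` {q1..q2})" using contg by (intro compact_continuous_image) auto
  then obtain Cg where Cg: "\<And>t. t \<in> {q1..q2} \<Longrightarrow> norm (g t) \<le> Cg"
    using compact_imp_bounded bounded_iff by (metis image_eqI)
  have Cg0: "Cg \<ge> 0" using Cg[of q2] q norm_ge_zero[of "g q2"] by (meson atLeastAtMost_iff less_imp_le order_refl order_trans)
  have gz: "g s = 0" if "s \<le> q1" for s
    unfolding g_def by (subst frac_int_cong[of s P0 "\<lambda>_. 0"]) (use that in \<open>auto simp: P0_def frac_int_def\<close>)
  interpret g: bounded_history g0 q1 Cg
  proof
    have "g \<in> borel_measurable borel" unfolding g_def by (rule P.frac_int_measurable)
    then show "g0 \<in> borel_measurable borel" unfolding g0_def by measurable
  qed (auto simp: g0_def gz Cg Cg0)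
  have int: "u t = c + integral {q1..t} g" if t: "t \<in> {q1..q2}" for t
  proof -
    have "u t = c + frac_int \<alpha> F0 t"
      unfolding u[OF t]
      by (subst scaled_integral_eq_frac_int[OF \<alpha>(1) F.bounded_history_axioms])
         (use t in \<open>auto simp: F0_def intro: continuous_on_subset[OF contF]\<close>)
    also have "frac_int \<alpha> F0 t = frac_int \<alpha> (frac_int 1 P0) t"
    proof (rule frac_int_cong)
      fix s assume s: "s < t"
      show "F0 s = frac_int 1 P0 s"
      proof (cases "s < q1")
        case True
        then show ?thesis by (subst frac_int_cong[of s P0 "\<lambda>_. 0"]) (auto simp: P0_def F0_def frac_int_def)
      qed (use s t FP in \<open>auto simp: F0_def\<close>)
    qed
    also have "\<dots> = frac_int 1 g t"
      using P.frac_int_semigroup[of \<alpha> 1 t] P.frac_int_semigroup[of 1 \<alpha> t] \<alpha> by (simp add: g_def add.commute)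
    also have "\<dots> = frac_int 1 g0 t"
      by (rule frac_int_cong) (use t in \<open>auto simp: g0_def gz\<close>)
    also have "\<dots> = integral {q1..t} g"
    proof (rule frac_int_1_eq_integral[OF g.bounded_history_axioms])
      have "(g has_integral integral {q1..t} g) {q1..t}"
        using t by (intro integrable_integral integrable_continuous_real continuous_on_subset[OF contg]) auto
      then show "(g0 has_integral integral {q1..t} g) {q1..t}"
        using t by (subst has_integral_cong[of _ _ g]) (auto simp: g0_def)
    qed (use t in auto)
    finally show ?thesis .
  qed
  have du: "(u has_vector_derivative g t) (at t within {q1..q2})" if t: "t \<in> {q1..q2}" for t
  proof -
    have "((\<lambda>t. c + integral {q1..t} g) has_vector_derivative 0 + g t) (at t within {q1..q2})"
      by (intro has_vector_derivative_add has_vector_derivative_const integral_has_vector_derivative contg t)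
    then have "((\<lambda>t. c + integral {q1..t} g) has_vector_derivative g t) (at t within {q1..q2})" by simp
    then show ?thesis by (rule has_vector_derivative_transform[OF t, rotated]) (use int in auto)
  qed
  have "caputo q1 \<alpha> u t = F t" if t: "t \<in> {q1..q2}" for t
  proof -
    let ?h = "\<lambda>s. frac_kernel (1 - \<alpha>) (t - s) *\<^sub>R g s"
    \<comment> \<open>the value of the integrand at the left end point, where the two-sided derivative is arbitrary\<close>
    define A where "A = complex_of_real (1 / Gamma (1 - \<alpha>) * (t - q1) powr (- \<alpha>)) * vector_derivative u (at q1)"
    have pt: "complex_of_real (1 / Gamma (1 - \<alpha>)) *
        (indicator {q1..t} s *\<^sub>R (complex_of_real ((t - s) powr (- \<alpha>)) * vector_derivative u (at s)))
        = (if s = q1 then A else ?h s)" for s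
    proof -
      consider "s < q1" | "s = q1" | "s > q1" "s < t" | "s \<ge> t" "s \<noteq> q1" by linarith
      then show ?thesis
      proof cases
        case 3
        then have "s \<in> {q1<..<q2}" using t by auto
        then have "(u has_vector_derivative g s) (at s)"
          using du[of s] by (simp add: at_within_Icc_at)
        then have "vector_derivative u (at s) = g s" by (rule vector_derivative_at)
        then show ?thesis using 3 by (simp add: frac_kernel_def scaleR_conv_of_real)
      next
        case 2
        then show ?thesis using t by (auto simp: A_def)
      qed (auto simp: frac_kernel_def gz indicator_def)
    qed
    have meas: "?h \<in> borel_measurable borel" unfolding g_def by measurable
    have "caputo q1 \<alpha> u t = (\<integral>s. (if s = q1 then A else ?h s) \<partial>lebesgue)"
      unfolding caputo_def set_lebesgue_integral_def pt[symmetric] by (rule integral_mult_right_zero[symmetric])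
    also have "\<dots> = (\<integral>s. (if s = q1 then A else ?h s) \<partial>lborel)"
      by (rule integral_completion) (use meas in measurable)
    also have "\<dots> = (\<integral>s. ?h s \<partial>lborel)"
    proof (rule integral_cong_AE)
      show "AE s in lborel. (if s = q1 then A else ?h s) = ?h s"
        using AE_lborel_singleton[of q1] by eventually_elim simp
    qed (use meas in measurable)
    also have "\<dots> = frac_int (1 - \<alpha>) (frac_int \<alpha> P0) t" by (simp add: frac_int_def[of "1 - \<alpha>"] g_def)
    also have "\<dots> = F t" using P.frac_int_semigroup[of "1 - \<alpha>" \<alpha> t] \<alpha> FP[OF t] by simp
    finally show ?thesis .
  qed
  with contg du show ?thesis by blast
qed

section \<open>Sectors and series of Gevrey type\<close>

lemma sectorI:
  assumes "0 < s" "s < q2 - q1 + r" "\<bar>\<theta>\<bar> < r"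
  shows "of_real q1 + of_real s * exp (\<i> * of_real \<theta>) \<in> sector q1 q2 r"
proof -
  have "s \<in> {0<..<q2 - q1 + r}" "\<theta> \<in> {-r<..<r}" using assms by auto
  then show ?thesis unfolding sector_def by blast
qed

lemma sector_iff:
  assumes "r > 0" "r \<le> pi"
  shows "z \<in> sector q1 q2 r \<longleftrightarrow> z \<noteq> of_real q1 \<and> norm (z - of_real q1) < q2 - q1 + r \<and>
    \<bar>Im (Ln (z - of_real q1))\<bar> < r"
proof
  assume "z \<in> sector q1 q2 r"
  then obtain s \<theta> where z: "z = of_real q1 + of_real s * exp (\<i> * of_real \<theta>)" and s: "0 < s" "s < q2 - q1 + r"
    and \<theta>: "- r < \<theta>" "\<theta> < r" unfolding sector_def by auto
  have e: "z - of_real q1 = exp (of_real (ln s) + \<i> * of_real \<theta>)"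
    using s by (simp add: z exp_add exp_of_real)
  have "Ln (z - of_real q1) = of_real (ln s) + \<i> * of_real \<theta>"
    unfolding e using \<theta> assms by (intro Ln_exp) auto
  moreover have "norm (z - of_real q1) = s" using s by (simp add: z norm_mult)
  ultimately show "z \<noteq> of_real q1 \<and> norm (z - of_real q1) < q2 - q1 + r \<and> \<bar>Im (Ln (z - of_real q1))\<bar> < r"
    using s \<theta> by auto
next
  assume *: "z \<noteq> of_real q1 \<and> norm (z - of_real q1) < q2 - q1 + r \<and> \<bar>Im (Ln (z - of_real q1))\<bar> < r"
  define w where "w = z - of_real q1"
  have w: "w \<noteq> 0" using * by (simp add: w_def)
  have "w = exp (Ln w)" using w by simp
  also have "\<dots> = of_real (norm w) * exp (\<i> * of_real (Im (Ln w)))"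
    using w by (subst exp_eq_polar) (simp add: cis_conv_exp exp_of_real)
  finally have "z = of_real q1 + of_real (norm w) * exp (\<i> * of_real (Im (Ln w)))"
    unfolding w_def by (simp add: algebra_simps)
  also have "\<dots> \<in> sector q1 q2 r"
    by (rule sectorI) (use * w in \<open>auto simp: w_def\<close>)
  finally show "z \<in> sector q1 q2 r" .
qed

lemma sector_mono: "r \<le> r' \<Longrightarrow> sector q1 q2 r \<subseteq> sector q1 q2 r'"
  unfolding sector_def by force

lemma real_in_sector:
  assumes "t \<in> {q1<..q2}" "r > 0"
  shows "of_real t \<in> sector q1 q2 r"
  using sectorI[of "t - q1" q2 q1 r 0] assms by auto

lemma sector_starlike:
  assumes "z \<in> sector q1 q2 r" "0 < x" "x \<le> 1"
  shows "of_real q1 + of_real x * (z - of_real q1) \<in> sector q1 q2 r"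
proof -
  from assms(1) obtain s \<theta> where z: "z = of_real q1 + of_real s * exp (\<i> * of_real \<theta>)" and s: "0 < s" "s < q2 - q1 + r"
    and \<theta>: "- r < \<theta>" "\<theta> < r" unfolding sector_def by auto
  have "x * s \<le> 1 * s" by (rule mult_right_mono) (use s assms in auto)
  then have "x * s < q2 - q1 + r" using s by linarith
  then show ?thesis using sectorI[of "x * s" q2 q1 r \<theta>] s \<theta> assms by (simp add: z mult.assoc abs_less_iff)
qed

lemma sector_slit:
  assumes "z \<in> sector q1 q2 r" "r > 0" "r \<le> pi"
  shows "z - of_real q1 \<notin> \<real>\<^sub>\<le>\<^sub>0"
proof
  assume "z - of_real q1 \<in> \<real>\<^sub>\<le>\<^sub>0"
  moreover have "z - of_real q1 \<noteq> 0" "\<bar>Im (Ln (z - of_real q1))\<bar> < pi"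
    using assms sector_iff[of r z q1 q2] by auto
  ultimately show False
    by (metis Im_Ln_eq_pi abs_of_pos complex_nonpos_Reals_iff complex_eq_iff less_eq_real_def order_less_irrefl pi_gt_zero zero_complex.sel)
qed

lemma open_sector:
  assumes "r > 0" "r \<le> pi"
  shows "open (sector q1 q2 r)"
proof -
  let ?U = "(\<lambda>z::complex. z - of_real q1) -` (- \<real>\<^sub>\<le>\<^sub>0)"
  have U: "open ?U" by (intro open_vimage continuous_intros open_Compl closed_nonpos_Reals_complex)
  have "sector q1 q2 r = ?U \<inter> (\<lambda>z. (norm (z - of_real q1), \<bar>Im (Ln (z - of_real q1))\<bar>)) -` ({..<q2 - q1 + r} \<times> {..<r})"
    using sector_slit[OF _ assms] sector_iff[OF assms] by auto
  also have "open \<dots>"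
    by (rule continuous_open_preimage[OF _ U]) (auto intro!: continuous_intros open_Times)
  finally show ?thesis .
qed

text \<open>The radius is proportional to both the opening and the distance to the vertex; this is the source
of the factors \<open>n^(1/k)\<close> and \<open>1 / (t - q1)\<close> in the derivative estimates.\<close>

lemma ball_subset_sector:
  assumes t: "t \<in> {q1<..q2}" and r: "0 < r" "r \<le> 1"
  shows "ball (of_real t) (r * (t - q1) / (2 + (q2 - q1))) \<subseteq> sector q1 q2 r"
proof
  fix z assume "z \<in> ball (complex_of_real t) (r * (t - q1) / (2 + (q2 - q1)))"
  then have z: "norm (z - of_real t) < r * (t - q1) / (2 + (q2 - q1))"
    by (simp add: dist_norm norm_minus_commute)
  define w where "w = (z - of_real t) / of_real (t - q1)"
  have tq: "0 < t - q1" "t - q1 \<le> q2 - q1" using t by auto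
  have nw: "norm w < r / (2 + (q2 - q1))"
    using z tq by (simp add: w_def norm_divide divide_less_eq field_simps del: of_real_diff)
  have "r / (2 + (q2 - q1)) \<le> r / 2" using tq r by (intro divide_left_mono) auto
  then have w2: "norm w < r / 2" using nw by linarith
  have zw: "z - of_real q1 = of_real (t - q1) * (1 + w)" using tq by (simp add: w_def field_simps)
  have "norm (Ln (1 + w)) \<le> 2 * norm w" by (rule norm_Ln_le) (use w2 r in auto)
  then have "\<bar>Im (Ln (1 + w))\<bar> < r" using w2 abs_Im_le_cmod[of "Ln (1 + w)"] by linarith
  moreover have nz: "1 + w \<noteq> 0"
  proof
    assume "1 + w = 0" then have "w = -1" by (simp add: add_eq_0_iff)
    then show False using w2 r by simp
  qed
  moreover have "Ln (of_real (t - q1) * (1 + w)) = of_real (ln (t - q1)) + Ln (1 + w)"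
    using Ln_times_of_real[OF tq(1) nz] Ln_of_real[OF tq(1)] by metis
  moreover have "norm (z - of_real q1) < q2 - q1 + r"
  proof -
    have "norm (z - of_real q1) \<le> norm (z - of_real t) + norm (of_real t - complex_of_real q1)"
      by (metis diff_add_cancel diff_diff_eq2 norm_triangle_ineq add_diff_eq)
    also have "norm (of_real t - complex_of_real q1) = t - q1"
      using tq by (metis abs_of_pos norm_of_real of_real_diff)
    also have "r * (t - q1) / (2 + (q2 - q1)) \<le> r"
      using tq r mult_left_mono[of "t - q1" "2 + (q2 - q1)" r] by (simp add: divide_le_eq)
    then have "norm (z - of_real t) < r" using z by linarith
    finally show ?thesis using tq by linarith
  qed
  moreover have "r \<le> pi" using r pi_gt3 by linarith
  ultimately have "\<bar>Im (Ln (z - of_real q1))\<bar> < r" "z - of_real q1 \<noteq> 0"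
    "norm (z - of_real q1) < q2 - q1 + r" "r \<le> pi"
    using tq unfolding zw by simp_all
  then show "z \<in> sector q1 q2 r" using sector_iff[OF r(1)] by auto
qed

lemma norm_in_sector: "z \<in> sector q1 q2 r \<Longrightarrow> 0 < norm (z - of_real q1) \<and> norm (z - of_real q1) < q2 - q1 + r"
  unfolding sector_def by (auto simp: norm_mult)

lemma sector_near_segment:
  assumes z: "z \<in> sector q1 q2 r" and q: "q1 < q2" and r: "r > 0"
  shows "\<exists>t\<in>{q1..q2}. dist (of_real t) z < r * (q2 - q1 + r) + r"
proof -
  from z obtain s \<theta> where z: "z = of_real q1 + of_real s * exp (\<i> * of_real \<theta>)" and s: "0 < s" "s < q2 - q1 + r"
    and \<theta>: "- r < \<theta>" "\<theta> < r" unfolding sector_def by auto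
  define t where "t = q1 + min s (q2 - q1)"
  have "norm (exp (\<i> * of_real \<theta>) - 1) \<le> \<bar>\<theta>\<bar>" 
    using dist_exp_i_1[of \<theta>] abs_sin_le_one[of "\<theta> / 2"] abs_sin_x_le_abs_x[of "\<theta> / 2"] by simp
  have "z - of_real t = of_real s * (exp (\<i> * of_real \<theta>) - 1) + of_real (s - min s (q2 - q1))"
    by (simp add: z t_def algebra_simps)
  then have "norm (z - of_real t) \<le> norm (of_real s * (exp (\<i> * of_real \<theta>) - 1)) + norm (complex_of_real (s - min s (q2 - q1)))"
    by (metis norm_triangle_ineq)
  also have "norm (of_real s * (exp (\<i> * of_real \<theta>) - 1)) \<le> s * \<bar>\<theta>\<bar>"
    using s \<open>norm (exp (\<i> * of_real \<theta>) - 1) \<le> \<bar>\<theta>\<bar>\<close> by (simp add: norm_mult)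
  also have "\<dots> \<le> (q2 - q1 + r) * r" by (rule mult_mono) (use s \<theta> in auto)
  also have "norm (complex_of_real (s - min s (q2 - q1))) < r"
    unfolding norm_of_real using s r by (auto simp: min_def)
  finally have "dist (of_real t) z < r * (q2 - q1 + r) + r" by (simp add: dist_norm norm_minus_commute mult.commute)
  moreover have "t \<in> {q1..q2}" using s q by (auto simp: t_def)
  ultimately show ?thesis by blast
qed

text \<open>This is how property \<open>S(k)\<close> forces \<open>\<psi>\<close> to map the real interval into itself.\<close>

lemma real_if_in_all_sectors:
  assumes z: "\<And>n. n \<ge> N \<Longrightarrow> z \<in> sector q1 q2 (\<rho> n)" and \<rho>: "\<rho> \<longlonglongrightarrow> 0" "\<And>n. n \<ge> N \<Longrightarrow> 0 < \<rho> n \<and> \<rho> n \<le> pi"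
  shows "\<exists>t\<in>{q1<..q2}. z = of_real t"
proof -
  let ?w = "z - of_real q1"
  have ev: "\<forall>\<^sub>F n in sequentially. n \<ge> N" by (rule eventually_ge_at_top)
  have "norm ?w \<le> q2 - q1 + 0"
  proof (rule tendsto_lowerbound)
    show "(\<lambda>n. q2 - q1 + \<rho> n) \<longlonglongrightarrow> q2 - q1 + 0" by (intro tendsto_intros \<rho>)
    show "\<forall>\<^sub>F n in sequentially. norm ?w \<le> q2 - q1 + \<rho> n"
      using ev by eventually_elim (use z norm_in_sector in \<open>force intro: less_imp_le\<close>)
  qed simp
  moreover have "\<bar>Im (Ln ?w)\<bar> \<le> 0"
  proof (rule tendsto_lowerbound[OF \<rho>(1)])
    show "\<forall>\<^sub>F n in sequentially. \<bar>Im (Ln ?w)\<bar> \<le> \<rho> n"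
      using ev
    proof eventually_elim
      case (elim n)
      then show ?case using z[of n] \<rho>(2)[of n] sector_iff[of "\<rho> n" z q1 q2] by auto
    qed
  qed simp
  moreover have w0: "?w \<noteq> 0" using z[of N] norm_in_sector by fastforce
  ultimately have "?w = of_real (norm ?w)"
    using exp_Ln[OF w0] exp_eq_polar[of "Ln ?w"] by (simp add: w0)
  then have "z = of_real (q1 + norm ?w)" by (simp add: algebra_simps)
  moreover have "q1 + norm ?w \<in> {q1<..q2}" using \<open>norm ?w \<le> q2 - q1 + 0\<close> w0 by simp
  ultimately show ?thesis by blast
qed

text \<open>Half of the geometric decay pays for the power: \<open>x^p e^(-\<mu> x) \<le> (p / \<mu>)^p\<close> with \<open>p = m / k\<close> and
\<open>e^(-\<mu>) = sqrt \<kappa>\<close>, and \<open>(p / \<mu>)^p\<close> is \<open>m^(m/k)\<close> up to a geometric factor. The other half,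
\<open>sqrt \<kappa> ^ j\<close>, keeps the series in \<open>j\<close> summable.\<close>

lemma gevrey_weight:
  fixes \<kappa> k :: real and N :: nat
  assumes \<kappa>: "0 < \<kappa>" "\<kappa> < 1" and k: "k > 0" and N: "N \<ge> 1"
  shows "\<exists>A>0. \<exists>E>0. \<forall>m j. \<kappa> ^ j * (real (N + j) powr (1 / k)) ^ m
    \<le> A * sqrt \<kappa> ^ j * E ^ m * (real m ^ m) powr (1 / k)"
proof -
  define \<mu> where "\<mu> = - ln (sqrt \<kappa>)"
  have sq: "0 < sqrt \<kappa>" "sqrt \<kappa> < 1" using \<kappa> by auto
  have \<mu>: "\<mu> > 0" using sq by (simp add: \<mu>_def ln_less_zero del: ln_sqrt real_sqrt_gt_0_iff real_sqrt_lt_1_iff)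
  have es: "sqrt \<kappa> ^ n = exp (- \<mu> * real n)" for n
    using sq by (simp add: \<mu>_def exp_of_nat_mult[symmetric] mult.commute del: ln_sqrt) (metis exp_ln exp_of_nat_mult sq(1))
  \<comment> \<open>compensates the shift of the index by \<open>N\<close>\<close>
  define A where "A = exp (\<mu> * real N)"
  define E where "E = (1 / (k * \<mu>)) powr (1 / k)"
  have bound: "exp (- \<mu> * x) * (x powr (1 / k)) ^ m \<le> E ^ m * (real m ^ m) powr (1 / k)" if x: "x \<ge> 1" for x m
  proof (cases "m = 0")
    case False
    define p where "p = real m / k"
    have p: "p > 0" using False k by (simp add: p_def)
    have "\<mu> * x / p \<le> exp (\<mu> * x / p)" using exp_ge_add_one_self[of "\<mu> * x / p"] by linarith
    then have "(\<mu> * x / p) powr p \<le> exp (\<mu> * x / p) powr p"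
      using p \<mu> x by (intro powr_mono2) auto
    also have "\<dots> = exp (\<mu> * x)" using p by (simp add: exp_powr_real)
    finally have "\<mu> powr p * x powr p / p powr p \<le> exp (\<mu> * x)"
      using \<mu> x p by (simp add: powr_mult powr_divide)
    then have "exp (- \<mu> * x) * x powr p \<le> (p / \<mu>) powr p"
      using \<mu> p by (simp add: exp_minus powr_divide field_simps)
    also have "(p / \<mu>) powr p = E ^ m * (real m ^ m) powr (1 / k)"
    proof -
      have "p / \<mu> = 1 / (k * \<mu>) * real m" by (simp add: p_def)
      then have "(p / \<mu>) powr p = (1 / (k * \<mu>)) powr p * real m powr p"
        using k \<mu> by (simp add: powr_mult[symmetric])
      moreover have "(1 / (k * \<mu>)) powr p = E ^ m"
        unfolding E_def p_def using k \<mu> by (simp add: powr_powr powr_realpow[symmetric])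
      moreover have "real m powr p = (real m ^ m) powr (1 / k)"
        unfolding p_def using False by (simp add: powr_powr powr_realpow[symmetric])
      ultimately show ?thesis by simp
    qed
    also have "x powr p = (x powr (1 / k)) ^ m"
      unfolding p_def using x by (simp add: powr_powr powr_realpow[symmetric])
    finally show ?thesis .
  qed (use \<mu> x in auto)
  have "\<kappa> ^ j * (real (N + j) powr (1 / k)) ^ m \<le> A * sqrt \<kappa> ^ j * E ^ m * (real m ^ m) powr (1 / k)" for m j
  proof -
    have "\<kappa> ^ j = sqrt \<kappa> ^ j * sqrt \<kappa> ^ j" using \<kappa> by (simp flip: power_mult_distrib)
    also have "\<dots> = sqrt \<kappa> ^ j * (A * exp (- \<mu> * real (N + j)))"
      by (simp add: es A_def flip: exp_add) (simp add: algebra_simps)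
    finally have "\<kappa> ^ j * (real (N + j) powr (1 / k)) ^ m
      = (A * sqrt \<kappa> ^ j) * (exp (- \<mu> * real (N + j)) * (real (N + j) powr (1 / k)) ^ m)" by simp
    also have "\<dots> \<le> (A * sqrt \<kappa> ^ j) * (E ^ m * (real m ^ m) powr (1 / k))"
      using bound[of "real (N + j)" m] N sq by (intro mult_left_mono) (auto simp: A_def)
    finally show ?thesis by (simp add: mult.assoc)
  qed
  moreover have "A > 0" "E > 0" using k \<mu> by (auto simp: A_def E_def)
  ultimately show ?thesis by blast
qed


text \<open>The terms are holomorphic on sectors whose opening tends to 0, hence the sum need not be analytic
on the interval; the rate \<open>j^(-1/k)\<close> against geometric decay gives Gevrey regularity.\<close>

lemma holomorphic_series_on_shrinking_sectors:
  fixes f :: "nat \<Rightarrow> complex \<Rightarrow> complex" and D C \<kappa> k :: real and N :: nat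
  assumes q: "q1 < q2" and k: "k > 0" and D: "0 < D" "D \<le> 1" and N: "N \<ge> 1" and \<kappa>: "0 < \<kappa>" "\<kappa> < 1"
    and hol: "\<And>j. f j holomorphic_on sector_seq q1 q2 k D (N + j)"
    and bd: "\<And>j z. z \<in> sector_seq q1 q2 k D (N + j) \<Longrightarrow> norm (f j z) \<le> C * \<kappa> ^ j"
  defines "U \<equiv> \<lambda>m t. \<Sum>j. (deriv ^^ m) (f j) (complex_of_real t)"
  shows "\<And>t. t \<in> {q1<..q2} \<Longrightarrow> (\<lambda>j. f j (of_real t)) sums U 0 t"
    and "\<And>m t. t \<in> {q1<..q2} \<Longrightarrow> (U m has_vector_derivative U (Suc m) t) (at t within {q1<..q2})"
    and "\<exists>A>0. \<exists>B>0. \<forall>m. \<forall>t\<in>{q1<..q2}. norm (U m t) \<le> A * fact m * (real m ^ m) powr (1 / k) * (B / (t - q1)) ^ m"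
proof -
  define r where "r j = D * real (N + j) powr (- 1 / k)" for j
  have r: "0 < r j" "r j \<le> 1" for j
  proof -
    have "1 \<le> real (N + j) powr (1 / k)" by (rule ge_one_powr_ge_zero) (use N k in auto)
    then have "real (N + j) powr (- 1 / k) \<le> 1" by (simp add: powr_minus_divide divide_le_eq_1)
    then show "r j \<le> 1" unfolding r_def using mult_mono[of D 1 "real (N + j) powr (- 1 / k)" 1] D by simp
  qed (use D N in \<open>simp add: r_def\<close>)
  have rpi: "r j \<le> pi" for j using r[of j] pi_gt3 by linarith
  have S: "sector_seq q1 q2 k D (N + j) = sector q1 q2 (r j)" for j by (simp add: sector_seq_def r_def)
  note hol' = hol[unfolded S] and bd' = bd[unfolded S]
  have C: "C \<ge> 0" using bd'[of "of_real q2" 0] real_in_sector[of q2 q1 q2 "r 0"] q r norm_ge_zero[of "f 0 (of_real q2)"]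
    by (metis greaterThanAtMost_iff mult.right_neutral order_refl order_trans power_0)
  obtain A E where A: "A > 0" and E: "E > 0"
    and AE: "\<And>m j. \<kappa> ^ j * (real (N + j) powr (1 / k)) ^ m \<le> A * sqrt \<kappa> ^ j * E ^ m * (real m ^ m) powr (1 / k)"
    using gevrey_weight[OF \<kappa> k N] by blast
  define c where "c = 2 * (2 + (q2 - q1)) / D"
  have c: "c > 0" using D q by (simp add: c_def)
  define M where "M m = fact m * C * A * (E * c) ^ m * (real m ^ m) powr (1 / k)" for m :: nat
  have M0: "M m \<ge> 0" for m using C A E c by (simp add: M_def)
  have key: "norm ((deriv ^^ m) (f j) (of_real t)) \<le> M m / (t - q1) ^ m * sqrt \<kappa> ^ j" if t: "t \<in> {q1<..q2}" for m j t
  proof -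
    define \<rho> where "\<rho> = r j * (t - q1) / (2 + (q2 - q1))"
    have \<rho>: "\<rho> > 0" using t r[of j] q by (simp add: \<rho>_def)
    have sub: "cball (of_real t) (\<rho> / 2) \<subseteq> sector q1 q2 (r j)"
    proof (rule subset_trans)
      show "cball (complex_of_real t) (\<rho> / 2) \<subseteq> ball (of_real t) \<rho>" using \<rho> by auto
      show "ball (of_real t) \<rho> \<subseteq> sector q1 q2 (r j)"
        unfolding \<rho>_def by (rule ball_subset_sector[OF t r(1,2)])
    qed
    have "norm ((deriv ^^ m) (f j) (of_real t)) \<le> fact m * (C * \<kappa> ^ j) / (\<rho> / 2) ^ m"
    proof (rule Cauchy_inequality)
      show "f j holomorphic_on ball (of_real t) (\<rho> / 2)"
        by (rule holomorphic_on_subset[OF hol']) (use sub in auto)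
      show "continuous_on (cball (of_real t) (\<rho> / 2)) (f j)"
        by (rule continuous_on_subset[OF holomorphic_on_imp_continuous_on[OF hol'] sub])
      show "norm (f j x) \<le> C * \<kappa> ^ j" if "norm (complex_of_real t - x) = \<rho> / 2" for x
        using that sub bd' by (auto simp: dist_norm)
    qed (use \<rho> in auto)
    also have "\<rho> / 2 = (t - q1) / (c * real (N + j) powr (1 / k))"
      using D by (simp add: \<rho>_def r_def c_def powr_minus_divide field_simps)
    also have "fact m * (C * \<kappa> ^ j) / ((t - q1) / (c * real (N + j) powr (1 / k))) ^ m
      = fact m * C * c ^ m / (t - q1) ^ m * (\<kappa> ^ j * (real (N + j) powr (1 / k)) ^ m)"
      by (simp add: power_divide power_mult_distrib)
    also have "\<dots> \<le> fact m * C * c ^ m / (t - q1) ^ m * (A * sqrt \<kappa> ^ j * E ^ m * (real m ^ m) powr (1 / k))"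
      by (rule mult_left_mono[OF AE]) (use C c t in auto)
    also have "\<dots> = M m / (t - q1) ^ m * sqrt \<kappa> ^ j"
      by (simp add: M_def power_mult_distrib)
    finally show ?thesis .
  qed
  have sq: "0 < sqrt \<kappa>" "sqrt \<kappa> < 1" using \<kappa> by auto
  then have geo: "summable (\<lambda>j. K * sqrt \<kappa> ^ j)" for K by (intro summable_mult summable_geometric) auto
  have summ: "summable (\<lambda>j. (deriv ^^ m) (f j) (complex_of_real t))" if "t \<in> {q1<..q2}" for m t
    by (rule summable_comparison_test'[OF geo, where N = 0]) (rule key[OF that])
  show "(\<lambda>j. f j (of_real t)) sums U 0 t" if "t \<in> {q1<..q2}" for t
    using summ[OF that, of 0] by (simp add: U_def summable_sums)
  have Ubd: "norm (U m t) \<le> M m / (t - q1) ^ m * (1 / (1 - sqrt \<kappa>))" if t: "t \<in> {q1<..q2}" for m t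
  proof -
    have "norm (U m t) \<le> (\<Sum>j. M m / (t - q1) ^ m * sqrt \<kappa> ^ j)"
      unfolding U_def by (intro norm_suminf_le key t geo)
    also have "\<dots> = M m / (t - q1) ^ m * (1 / (1 - sqrt \<kappa>))"
      using sq by (subst suminf_mult) (auto simp: suminf_geometric summable_geometric)
    finally show ?thesis .
  qed
  show "\<exists>A>0. \<exists>B>0. \<forall>m. \<forall>t\<in>{q1<..q2}. norm (U m t) \<le> A * fact m * (real m ^ m) powr (1 / k) * (B / (t - q1)) ^ m"
  proof (intro exI conjI allI ballI)
    show "(C + 1) * A / (1 - sqrt \<kappa>) > 0" using C A sq by simp
    show "E * c > 0" using E c by simp
    fix m t assume t: "t \<in> {q1<..q2}"
    have "norm (U m t) \<le> M m / (t - q1) ^ m * (1 / (1 - sqrt \<kappa>))" by (rule Ubd[OF t])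
    also have "\<dots> = C * (A / (1 - sqrt \<kappa>) * fact m * (real m ^ m) powr (1 / k) * (E * c / (t - q1)) ^ m)"
      by (simp add: M_def power_divide mult_ac)
    also have "\<dots> \<le> (C + 1) * (A / (1 - sqrt \<kappa>) * fact m * (real m ^ m) powr (1 / k) * (E * c / (t - q1)) ^ m)"
      by (rule mult_right_mono) (use A sq E c t in auto)
    finally show "norm (U m t) \<le> (C + 1) * A / (1 - sqrt \<kappa>) * fact m * (real m ^ m) powr (1 / k) * (E * c / (t - q1)) ^ m"
      by simp
  qed
  show "(U m has_vector_derivative U (Suc m) t) (at t within {q1<..q2})" if t: "t \<in> {q1<..q2}" for m t
  proof -
    define q where "q = (q1 + t) / 2"
    have q: "q1 < q" "q < t" using t by (auto simp: q_def)
    let ?S = "complex_of_real ` {q..q2}"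
    have ul: "uniform_limit ?S (\<lambda>n x. \<Sum>i<n. (deriv ^^ Suc m) (f i) x) (\<lambda>x. \<Sum>i. (deriv ^^ Suc m) (f i) x) sequentially"
    proof (rule Weierstrass_m_test)
      fix j x assume "x \<in> ?S"
      then obtain s where s: "x = of_real s" "q \<le> s" "s \<le> q2" by auto
      have "norm ((deriv ^^ Suc m) (f j) x) \<le> M (Suc m) / (s - q1) ^ Suc m * sqrt \<kappa> ^ j"
        unfolding s(1) by (rule key) (use s q in auto)
      also have "\<dots> \<le> M (Suc m) / (q - q1) ^ Suc m * sqrt \<kappa> ^ j"
        using s q M0 sq by (intro mult_right_mono divide_left_mono power_mono) (auto intro!: mult_pos_pos)
      finally show "norm ((deriv ^^ Suc m) (f j) x) \<le> M (Suc m) / (q - q1) ^ Suc m * sqrt \<kappa> ^ j" .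
    qed (rule geo)
    have dj: "((deriv ^^ m) (f j) has_field_derivative (deriv ^^ Suc m) (f j) x) (at x within ?S)" if "x \<in> ?S" for j x
    proof -
      have "x \<in> sector q1 q2 (r j)" using that q r by (auto intro!: real_in_sector)
      then have "((deriv ^^ m) (f j) has_field_derivative deriv ((deriv ^^ m) (f j)) x) (at x)"
        by (rule holomorphic_derivI[OF holomorphic_higher_deriv[OF hol' open_sector[OF r(1) rpi]] open_sector[OF r(1) rpi]])
      then show ?thesis by (simp add: has_field_derivative_at_within)
    qed
    have "convex ?S" by (intro convex_linear_image) (auto intro: bounded_linear.linear bounded_linear_of_real)
    moreover have "complex_of_real t \<in> ?S" using t q by auto
    ultimately obtain G where G: "\<And>x. x \<in> ?S \<Longrightarrow> (\<lambda>n. (deriv ^^ m) (f n) x) sums G x"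
      "\<And>x. x \<in> ?S \<Longrightarrow> (G has_field_derivative (\<Sum>i. (deriv ^^ Suc m) (f i) x)) (at x within ?S)"
      using has_field_derivative_series[OF _ dj ul _ summ[OF t]] by blast
    have "(G has_field_derivative U (Suc m) t) (at (of_real t) within ?S)"
      using G(2)[of "of_real t"] t q by (auto simp: U_def)
    moreover have "(complex_of_real has_vector_derivative 1) (at t within {q..q2})"
      by (auto intro!: derivative_eq_intros)
    ultimately have "((G \<circ> complex_of_real) has_vector_derivative 1 * U (Suc m) t) (at t within {q..q2})"
      by (intro field_vector_diff_chain_within)
    then have "(U m has_vector_derivative U (Suc m) t) (at t within {q..q2})"
      by (intro has_vector_derivative_transform[of t "{q..q2}" "U m" "G \<circ> complex_of_real"])
         (use t q G(1) in \<open>auto simp: U_def sums_iff\<close>)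
    moreover have "at t within {q1<..q2} = at t within {q..q2}"
      by (rule at_within_nhd[of _ "{q<..}"]) (use q t in auto)
    ultimately show ?thesis by simp
  qed
qed

lemma nth_deriv_on_eq:
  assumes deriv: "\<And>m t. t \<in> S \<Longrightarrow> (U m has_vector_derivative U (Suc m) t) (at t within S)"
    and S: "\<And>t. t \<in> S \<Longrightarrow> at t within S \<noteq> bot" and t: "t \<in> S"
    and u: "\<And>t. t \<in> S \<Longrightarrow> u t = U 0 t"
  shows "nth_deriv_on S m u t = U m t"
  using t
proof (induction m arbitrary: t)
  case 0
  then show ?case by (simp add: nth_deriv_on_def u)
next
  case (Suc m)
  have "(nth_deriv_on S m u has_vector_derivative U (Suc m) t) (at t within S)"
    by (rule has_vector_derivative_transform[OF Suc.prems Suc.IH deriv[OF Suc.prems]])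
  then have "vector_derivative (nth_deriv_on S m u) (at t within S) = U (Suc m) t"
    by (rule vector_derivative_within[OF S[OF Suc.prems]])
  then show ?case by (simp add: nth_deriv_on_def)
qed

lemma Cinf_onI:
  assumes deriv: "\<And>m t. t \<in> S \<Longrightarrow> (U m has_vector_derivative U (Suc m) t) (at t within S)"
    and S: "\<And>t. t \<in> S \<Longrightarrow> at t within S \<noteq> bot"
    and u: "\<And>t. t \<in> S \<Longrightarrow> u t = U 0 t"
  shows "Cinf_on S u"
proof -
  note eq = nth_deriv_on_eq[of S U, OF deriv S _ u]
  have d: "(nth_deriv_on S j u has_vector_derivative U (Suc j) t) (at t within S)" if "t \<in> S" for j t
    by (rule has_vector_derivative_transform[OF that eq deriv[OF that]])
  then show ?thesis unfolding Cinf_on_def Ck_on_def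
    by (meson continuous_on_vector_derivative differentiableI_vector)
qed

lemma at_within_interval_neq_bot:
  fixes t :: real
  assumes "p < t" "{p<..<t} \<subseteq> S \<or> {t<..<p'} \<subseteq> S" "t < p'"
  shows "at t within S \<noteq> bot"
  using assms islimpt_greaterThanLessThan1[of t p'] islimpt_greaterThanLessThan2[of p t] islimpt_subset trivial_limit_within
  by metis

lemma gevrey_boundI:
  fixes u :: "real \<Rightarrow> complex" and U :: "nat \<Rightarrow> real \<Rightarrow> complex"
  assumes q: "q1 < q2" and C1: "Ck_on 1 {q1..q2} u"
    and deriv: "\<And>m t. t \<in> {q1<..q2} \<Longrightarrow> (U m has_vector_derivative U (Suc m) t) (at t within {q1<..q2})"
    and u: "\<And>t. t \<in> {q1<..q2} \<Longrightarrow> u t = U 0 t"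
    and AB: "A > 0" "B > 0"
    and bd: "\<And>m t. t \<in> {q1<..q2} \<Longrightarrow> norm (U m t) \<le> A * fact m * (real m ^ m) powr (1 / k) * (B / (t - q1)) ^ m"
  shows "u \<in> gevrey_bound k q1 q2"
  unfolding gevrey_bound_def
proof (intro CollectI conjI ballI C1)
  have nt: "at t within {q1<..q2} \<noteq> bot" if "t \<in> {q1<..q2}" for t
    using that by (intro at_within_interval_neq_bot[of q1 t _ "t + 1"]) auto
  show "Cinf_on {q1<..q2} u" by (rule Cinf_onI[OF deriv nt u])
  fix q assume q': "q \<in> {q1<..<q2}"
  have nt': "at t within {q..q2} \<noteq> bot" if "t \<in> {q..q2}" for t
  proof (cases "t = q")
    case True
    then show ?thesis using q' by (intro at_within_interval_neq_bot[of "t - 1" t _ q2]) auto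
  next
    case False
    then show ?thesis using that by (intro at_within_interval_neq_bot[of q t _ "t + 1"]) auto
  qed
  have deriv': "(U m has_vector_derivative U (Suc m) t) (at t within {q..q2})" if "t \<in> {q..q2}" for m t
    by (rule has_vector_derivative_within_subset[OF deriv]) (use that q' in auto)
  have u': "u t = U 0 t" if "t \<in> {q..q2}" for t using that q' u by auto
  define b where "b = max 1 (B / (q - q1)) + A"
  have "sup_norm {q..q2} (nth_deriv_on {q..q2} m u) \<le> b ^ (m + 1) * (real m ^ m) powr (1 + 1 / k)" for m
    unfolding sup_norm_def
  proof (rule cSUP_least)
    fix t assume t: "t \<in> {q..q2}"
    have fm: "fact m \<le> real m ^ m" using fact_le_power[of m, where 'a = real] by simp
    have "norm (nth_deriv_on {q..q2} m u t) = norm (U m t)"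
      by (subst nth_deriv_on_eq[of "{q..q2}" U, OF deriv' nt' t u']) auto
    also have "\<dots> \<le> A * fact m * (real m ^ m) powr (1 / k) * (B / (t - q1)) ^ m"
      by (rule bd) (use t q' in auto)
    also have "\<dots> \<le> b * (real m ^ m) * (real m ^ m) powr (1 / k) * b ^ m"
    proof (intro mult_mono power_mono)
      have "B / (t - q1) \<le> B / (q - q1)" by (rule divide_left_mono) (use t q' AB in auto)
      then show "B / (t - q1) \<le> b" using AB by (simp add: b_def)
    qed (use AB t q' fm in \<open>auto simp: b_def\<close>)
    also have "\<dots> = b ^ (m + 1) * (real m ^ m) powr (1 + 1 / k)"
    proof -
      have "real m ^ m > 0" by (cases m) auto
      then show ?thesis by (simp add: powr_add)
    qed
    finally show "norm (nth_deriv_on {q..q2} m u t) \<le> b ^ (m + 1) * (real m ^ m) powr (1 + 1 / k)" .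
  qed (use q' in auto)
  moreover have "b > 0" using AB by (simp add: b_def)
  ultimately show "u \<in> gevrey k q q2"
    unfolding gevrey_def using Cinf_onI[of "{q..q2}" U, OF deriv' nt' u'] by blast
qed


section \<open>Vanishing factors, telescoping limits and Lipschitz bounds\<close>

text \<open>Gives continuity at the vertex \<open>q1\<close> of products whose second factor is merely bounded near it.\<close>

lemma continuous_on_mult_vanishing:
  fixes A G :: "'a::t2_space \<Rightarrow> complex"
  assumes A: "continuous_on X A" and Y: "openin (top_of_set X) Y" and G: "continuous_on Y G"
    and zero: "\<And>x. x \<in> X - Y \<Longrightarrow> A x = 0" and bd: "\<And>x. x \<in> Y \<Longrightarrow> norm (G x) \<le> M"
  shows "continuous_on X (\<lambda>x. A x * G x)"
  unfolding continuous_on_def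
proof
  fix x assume x: "x \<in> X"
  obtain T where T: "open T" "Y = X \<inter> T" using Y by (auto simp: openin_open)
  have At: "(A \<longlongrightarrow> A x) (at x within X)" using A x by (auto simp: continuous_on_def)
  show "((\<lambda>x. A x * G x) \<longlongrightarrow> A x * G x) (at x within X)"
  proof (cases "x \<in> Y")
    case True
    have "at x within X = at x within Y"
      by (rule at_within_nhd[of x T]) (use True T in auto)
    then have "(G \<longlongrightarrow> G x) (at x within X)" using G True by (auto simp: continuous_on_def)
    with At show ?thesis by (rule tendsto_mult)
  next
    case False
    with x zero have A0: "A x = 0" by auto
    have "((\<lambda>x. A x * G x) \<longlongrightarrow> 0) (at x within X)"
    proof (rule Lim_null_comparison)
      show "\<forall>\<^sub>F y in at x within X. norm (A y * G y) \<le> norm (A y) * M"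
        unfolding eventually_at_filter
      proof (rule always_eventually, intro allI impI)
        fix y assume "y \<in> X"
        then show "norm (A y * G y) \<le> norm (A y) * M"
          using zero[of y] bd[of y] by (cases "y \<in> Y") (auto simp: norm_mult intro: mult_left_mono)
      qed
      have "((\<lambda>y. norm (A y) * M) \<longlongrightarrow> norm (A x) * M) (at x within X)" by (intro tendsto_intros At)
      then show "((\<lambda>y. norm (A y) * M) \<longlongrightarrow> 0) (at x within X)" by (simp add: A0)
    qed
    then show ?thesis by (simp add: A0)
  qed
qed

text \<open>True of every function, because the integral of a non-integrable one is 0 by convention.\<close>

lemma norm_integral_01_le:
  fixes f :: "real \<Rightarrow> complex"
  assumes "\<And>t. t \<in> {0..1} \<Longrightarrow> norm (f t) \<le> Q"
  shows "norm (integral {0..1} f) \<le> Q"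
proof (cases "f integrable_on {0..1}")
  case True
  then show ?thesis using integral_norm_bound_integral[OF True integrable_const_ivl[of Q 0 1]] assms by simp
next
  case False
  moreover have "0 \<le> Q" using assms[of 0] norm_ge_zero[of "f 0"] by (simp del: norm_ge_zero)
  ultimately show ?thesis by (simp add: not_integrable_integral)
qed

lemma LIMSEQ_telescoping:
  fixes X :: "nat \<Rightarrow> complex"
  assumes "(\<lambda>j. X (Suc j) - X j) sums s"
  shows "X \<longlonglongrightarrow> X 0 + s"
proof -
  have "(\<lambda>n. X 0 + (\<Sum>j<n. X (Suc j) - X j)) \<longlonglongrightarrow> X 0 + s"
    using assms unfolding sums_def by (intro tendsto_intros)
  then show ?thesis by (simp add: sum_lessThan_telescope)
qed

lemma norm_powr_of_real_exponent: "norm (w powr complex_of_real x) = norm w powr x"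
  by (cases "w = 0") (simp_all add: powr_def)

lemma compact_bound:
  fixes f :: "'a::metric_space \<Rightarrow> complex"
  assumes "compact K" "continuous_on K f"
  obtains B where "B > 0" "\<And>x. x \<in> K \<Longrightarrow> norm (f x) \<le> B"
  using compact_imp_bounded[OF compact_continuous_image[OF assms(2,1)]] unfolding bounded_pos by auto

lemma holomorphic_Lipschitz_on_compact_convex:
  assumes "f holomorphic_on U" "open U" "compact K" "convex K" "K \<subseteq> U"
  obtains B where "B > 0" "\<And>x y. x \<in> K \<Longrightarrow> y \<in> K \<Longrightarrow> norm (f x - f y) \<le> B * norm (x - y)"
proof -
  have c: "continuous_on K (deriv f)"
    using holomorphic_on_imp_continuous_on[OF holomorphic_deriv[OF assms(1,2)]] assms(5) continuous_on_subset by blast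
  then obtain B where B: "B > 0" "\<And>x. x \<in> K \<Longrightarrow> norm (deriv f x) \<le> B" using compact_bound assms(3) by metis
  have "(f has_field_derivative deriv f x) (at x within K)" if "x \<in> K" for x
    using holomorphic_derivI[OF assms(1,2)] that assms(5) by blast
  from field_differentiable_bound[OF assms(4) this B(2)] B(1) that show ?thesis by blast
qed

section \<open>Successive approximations on shrinking sectors\<close>

text \<open>The hypotheses isolate what the iteration needs: \<open>R\<close> is the radius of an invariant ball, \<open>\<theta>\<close> the
factor by which the operator shrinks it, and \<open>Q\<close> a bound for the right-hand side on the largest sector.\<close>

locale fractional_equation =
  fixes q1 q2 k \<alpha> D \<theta> R M Q :: real and N :: nat and lam :: complex
    and a b \<psi> \<Phi> :: "complex \<Rightarrow> complex" and \<Omega> :: "complex set"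
  assumes q: "q1 < q2" and k: "k > 0" and \<alpha>: "0 < \<alpha>" "\<alpha> < 1" and D: "0 < D" "D \<le> 1" and N: "N \<ge> 1"
    and R: "R > 0" and \<theta>: "0 < \<theta>" "\<theta> < 1"
    and \<Omega>: "open \<Omega>" "of_real ` {q1..q2} \<subseteq> \<Omega>" "sector_seq q1 q2 k D N \<subseteq> \<Omega>"
    and a: "a holomorphic_on \<Omega>" and b: "b holomorphic_on \<Omega>" and \<psi>: "\<psi> holomorphic_on \<Omega>" and \<Phi>: "\<Phi> holomorphic_on UNIV"
    and a0: "a (of_real q1) = 0" and b0: "b (of_real q1) = 0"
    and M: "\<And>w. norm w \<le> R \<Longrightarrow> norm (\<Phi> w) \<le> M"
    and Q: "\<And>z. z \<in> sector_seq q1 q2 k D N \<Longrightarrow> norm (a z) * M + norm (b z) \<le> Q"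
    and self: "norm lam + (q2 - q1 + D) powr \<alpha> / Gamma (\<alpha> + 1) * Q < \<theta> * R"
    and \<psi>S: "\<And>n. n \<ge> N \<Longrightarrow> \<psi> ` sector_seq q1 q2 k D (n + 1) \<subseteq> sector_seq q1 q2 k D n"
begin

definition r :: "nat \<Rightarrow> real" where "r j = D * real (N + j) powr (- 1 / k)"

definition S :: "nat \<Rightarrow> complex set" where "S j = sector q1 q2 (r j)"

definition rhs :: "(complex \<Rightarrow> complex) \<Rightarrow> complex \<Rightarrow> complex" where
  "rhs y \<xi> = a \<xi> * \<Phi> (y (\<psi> \<xi>)) + b \<xi>"

definition ray :: "complex \<Rightarrow> real \<Rightarrow> complex" where
  "ray z \<tau> = of_real q1 + of_real (1 - \<tau> powr (1 / \<alpha>)) * (z - of_real q1)"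

text \<open>The integrand is taken along the segment from \<open>q1\<close> to \<open>z\<close>, parametrised as in
\<open>scaled_integral_eq_frac_int\<close>; apart from its vertex \<open>q1\<close> the segment stays in
every sector that contains \<open>z\<close>.\<close>

definition T :: "(complex \<Rightarrow> complex) \<Rightarrow> complex \<Rightarrow> complex" where
  "T y z = lam + (z - of_real q1) powr of_real \<alpha> / of_real (Gamma (\<alpha> + 1)) * integral {0..1} (\<lambda>\<tau>. rhs y (ray z \<tau>))"

lemma S_eq: "S j = sector_seq q1 q2 k D (N + j)"
  by (simp add: S_def r_def sector_seq_def)

lemma r_pos: "r j > 0"
  using D N by (simp add: r_def)

lemma r_le_D: "r j \<le> D"
proof -
  have "1 \<le> real (N + j) powr (1 / k)" by (rule ge_one_powr_ge_zero) (use N k in auto)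
  then have "real (N + j) powr (- 1 / k) \<le> 1" by (simp add: powr_minus_divide divide_le_eq_1)
  then show ?thesis unfolding r_def using mult_left_mono[of _ 1 D] D by simp
qed

lemma r_le_pi: "r j \<le> pi"
  using r_le_D[of j] D pi_gt3 by linarith

lemma r_Suc: "r (Suc j) \<le> r j"
  unfolding r_def using D N k by (intro mult_left_mono powr_mono2') auto

lemma r_tendsto_0: "r \<longlonglongrightarrow> 0"
proof -
  have "filterlim (\<lambda>j. real (N + j)) at_top sequentially"
    by (rule filterlim_compose[OF filterlim_real_sequentially]) (rule filterlim_add_const_nat_at_top[of N, unfolded add.commute[of _ N]])
  then have "(\<lambda>j. real (N + j) powr (- 1 / k)) \<longlonglongrightarrow> 0"
    by (rule tendsto_neg_powr[rotated]) (use k in auto)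
  then have "(\<lambda>j. D * real (N + j) powr (- 1 / k)) \<longlonglongrightarrow> D * 0" by (intro tendsto_intros)
  then show ?thesis by (simp add: r_def[abs_def])
qed

lemma open_S: "open (S j)"
  unfolding S_def by (rule open_sector[OF r_pos r_le_pi])

lemma S_Suc: "S (Suc j) \<subseteq> S j"
  unfolding S_def by (rule sector_mono[OF r_Suc])

lemma S_subset_0: "S j \<subseteq> S 0"
  by (induction j) (use S_Suc in auto)

lemma S_subset_\<Omega>: "S j \<subseteq> \<Omega>"
  using S_subset_0[of j] \<Omega>(3) by (auto simp: S_eq)

lemma \<psi>_S: "z \<in> S (Suc j) \<Longrightarrow> \<psi> z \<in> S j"
  using \<psi>S[of "N + j"] by (auto simp: S_eq)

lemma real_in_S: "t \<in> {q1<..q2} \<Longrightarrow> of_real t \<in> S j"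
  unfolding S_def by (rule real_in_sector[OF _ r_pos])

lemma slit_S: "z \<in> S j \<Longrightarrow> z - of_real q1 \<notin> \<real>\<^sub>\<le>\<^sub>0"
  unfolding S_def by (rule sector_slit[OF _ r_pos r_le_pi])

lemma Q_nonneg: "Q \<ge> 0"
proof -
  have "0 \<le> M" using M[of 0] R norm_ge_zero[of "\<Phi> 0"] by (simp del: norm_ge_zero)
  then have "0 \<le> norm (a (of_real q2)) * M + norm (b (of_real q2))" by simp
  also have "\<dots> \<le> Q" by (rule Q) (use real_in_S[of q2 0] q in \<open>auto simp: S_eq\<close>)
  finally show ?thesis .
qed

lemma Gamma_pos: "Gamma (\<alpha> + 1) > 0"
  using \<alpha> by (intro Gamma_real_pos) auto

lemma lam_bound: "norm lam < \<theta> * R"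
proof -
  have "0 \<le> (q2 - q1 + D) powr \<alpha> / Gamma (\<alpha> + 1) * Q" using Q_nonneg Gamma_pos by simp
  then show ?thesis using self by linarith
qed

lemma ray_1: "ray z 1 = of_real q1"
  by (simp add: ray_def)

lemma ray_in_S:
  assumes "z \<in> S j" "\<tau> \<in> {0..<1}"
  shows "ray z \<tau> \<in> S j"
proof -
  have "\<tau> powr (1 / \<alpha>) < 1 powr (1 / \<alpha>)" by (rule powr_less_mono2) (use assms \<alpha> in auto)
  then show ?thesis using sector_starlike[of z q1 q2 "r j" "1 - \<tau> powr (1 / \<alpha>)"] assms by (simp add: S_def ray_def)
qed

lemma continuous_ray: "continuous_on (UNIV \<times> {0..1}) (\<lambda>(z, \<tau>). ray z \<tau>)"
  unfolding ray_def case_prod_unfold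
  using \<alpha> by (intro continuous_intros continuous_on_powr') auto

lemma rhs_at_q1: "rhs y (of_real q1) = 0"
  by (simp add: rhs_def a0 b0)

lemma rhs_bound:
  assumes "z \<in> S j" "norm (y (\<psi> z)) \<le> R"
  shows "norm (rhs y z) \<le> Q"
proof -
  have "norm (rhs y z) \<le> norm (a z) * norm (\<Phi> (y (\<psi> z))) + norm (b z)"
    unfolding rhs_def by (metis norm_mult norm_triangle_ineq)
  also have "\<dots> \<le> norm (a z) * M + norm (b z)" using M assms(2) by (intro add_mono mult_left_mono) auto
  also have "\<dots> \<le> Q" using Q assms S_subset_0[of j] by (auto simp: S_eq)
  finally show ?thesis .
qed

lemma rhs_ray_bound:
  assumes z: "z \<in> S (Suc j)" and y: "\<And>x. x \<in> S j \<Longrightarrow> norm (y x) \<le> R" and \<tau>: "\<tau> \<in> {0..1}"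
  shows "norm (rhs y (ray z \<tau>)) \<le> Q"
proof (cases "\<tau> = 1")
  case False
  then have "ray z \<tau> \<in> S (Suc j)" using ray_in_S[OF z] \<tau> by auto
  then show ?thesis using rhs_bound y \<psi>_S by blast
qed (simp add: ray_1 rhs_at_q1 Q_nonneg)

lemma T_bound:
  assumes z: "z \<in> S (Suc j)" and y: "\<And>x. x \<in> S j \<Longrightarrow> norm (y x) \<le> R"
  shows "norm (T y z) < \<theta> * R"
proof -
  have "norm (T y z) \<le> norm lam + norm ((z - of_real q1) powr of_real \<alpha> / of_real (Gamma (\<alpha> + 1)) * integral {0..1} (\<lambda>\<tau>. rhs y (ray z \<tau>)))"
    unfolding T_def by (rule norm_triangle_ineq)
  also have "norm ((z - of_real q1) powr of_real \<alpha> / of_real (Gamma (\<alpha> + 1)) * integral {0..1} (\<lambda>\<tau>. rhs y (ray z \<tau>)))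
     = norm (z - of_real q1) powr \<alpha> / Gamma (\<alpha> + 1) * norm (integral {0..1} (\<lambda>\<tau>. rhs y (ray z \<tau>)))"
    using Gamma_pos by (simp add: norm_mult norm_divide norm_powr_of_real_exponent)
  also have "\<dots> \<le> (q2 - q1 + D) powr \<alpha> / Gamma (\<alpha> + 1) * Q"
  proof (intro mult_mono divide_right_mono powr_mono2)
    show "norm (z - of_real q1) \<le> q2 - q1 + D"
      using norm_in_sector[of z q1 q2 "r (Suc j)"] z r_le_D[of "Suc j"] by (auto simp: S_def)
    show "norm (integral {0..1} (\<lambda>\<tau>. rhs y (ray z \<tau>))) \<le> Q"
      by (rule norm_integral_01_le) (rule rhs_ray_bound[OF z y])
  qed (use \<alpha> Gamma_pos q D in auto)
  also note self
  finally show ?thesis by simp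
qed

text \<open>This serves twice: with \<open>p\<close> the end point of the segment, for the holomorphy of \<open>T y\<close>, and with \<open>p\<close> the
parameter of an analytic disc of functions, for the contraction estimate. At \<open>\<tau> = 1\<close> the argument is the
vertex \<open>q1\<close>, where \<open>\<psi>\<close> may leave the sector; the zero of \<open>a\<close> compensates.\<close>

lemma continuous_rhs_ray:
  fixes Z :: "'p::metric_space \<Rightarrow> complex" and h :: "'p \<Rightarrow> complex \<Rightarrow> complex"
  assumes Z: "continuous_on U Z" "\<And>p. p \<in> U \<Longrightarrow> Z p \<in> S (Suc j)"
    and h: "continuous_on (U \<times> S j) (\<lambda>(p, x). h p x)"
    and bd: "\<And>p x. p \<in> U \<Longrightarrow> x \<in> S j \<Longrightarrow> norm (h p x) \<le> R"
  shows "continuous_on (U \<times> {0..1}) (\<lambda>(p, \<tau>). rhs (h p) (ray (Z p) \<tau>))"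
proof -
  let ?X = "U \<times> {0..1::real}" and ?Y = "U \<times> {0..<1::real}"
  let ?g = "\<lambda>(p, \<tau>). ray (Z p) \<tau>"
  have cg: "continuous_on ?X ?g"
  proof -
    have "continuous_on ?X (\<lambda>x. (Z (fst x), snd x))"
      by (intro continuous_intros continuous_on_compose2[OF Z(1)]) auto
    from continuous_on_compose2[OF continuous_ray this] show ?thesis by (auto simp: case_prod_unfold image_subset_iff)
  qed
  have gY: "?g x \<in> S (Suc j)" if "x \<in> ?Y" for x using that ray_in_S Z(2) by auto
  have g\<Omega>: "?g x \<in> \<Omega>" if "x \<in> ?X" for x
  proof (cases "x \<in> ?Y")
    case False
    then have "snd x = 1" using that by (cases x) auto
    moreover have "complex_of_real q1 \<in> \<Omega>" using \<Omega>(2) q by auto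
    ultimately show ?thesis by (simp add: case_prod_unfold ray_1)
  qed (use gY S_subset_\<Omega> in blast)
  have comp: "continuous_on ?X (\<lambda>x. f (?g x))" if "f holomorphic_on \<Omega>" for f
    by (rule continuous_on_compose2[OF holomorphic_on_imp_continuous_on[OF that] cg]) (use g\<Omega> in auto)
  have "continuous_on ?X (\<lambda>x. a (?g x) * \<Phi> (h (fst x) (\<psi> (?g x))))"
  proof (rule continuous_on_mult_vanishing[OF comp[OF a], of ?Y])
    show "openin (top_of_set ?X) ?Y"
      unfolding openin_open by (rule exI[of _ "UNIV \<times> {..<1}"]) (auto intro: open_Times)
    have "continuous_on ?Y (\<lambda>x. \<psi> (?g x))" by (rule continuous_on_subset[OF comp[OF \<psi>]]) auto
    then have "continuous_on ?Y (\<lambda>x. (fst x, \<psi> (?g x)))" by (intro continuous_intros)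
    from continuous_on_compose2[OF h this]
    have "continuous_on ?Y (\<lambda>x. h (fst x) (\<psi> (?g x)))"
      using gY \<psi>_S by (auto simp: case_prod_unfold image_subset_iff)
    then show "continuous_on ?Y (\<lambda>x. \<Phi> (h (fst x) (\<psi> (?g x))))"
      by (rule continuous_on_compose2[OF holomorphic_on_imp_continuous_on[OF \<Phi>]]) auto
    show "a (?g x) = 0" if "x \<in> ?X - ?Y" for x
    proof -
      have "snd x = 1" using that by (cases x) auto
      then show ?thesis by (simp add: case_prod_unfold ray_1 a0)
    qed
    show "norm (\<Phi> (h (fst x) (\<psi> (?g x)))) \<le> M" if "x \<in> ?Y" for x
      by (rule M, rule bd) (use that gY[OF that] \<psi>_S in auto)
  qed
  from continuous_on_add[OF this comp[OF b]] show ?thesis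
    by (simp add: rhs_def case_prod_unfold)
qed

lemma T_holomorphic:
  assumes y: "y holomorphic_on S j" and bd: "\<And>x. x \<in> S j \<Longrightarrow> norm (y x) \<le> R"
  shows "T y holomorphic_on S (Suc j)"
proof -
  have "(\<lambda>z. integral {0..1} (\<lambda>\<tau>. rhs y (ray z \<tau>))) holomorphic_on S (Suc j)"
  proof (rule holomorphic_on_integral_param[OF open_S])
    have "continuous_on (S (Suc j) \<times> S j) (\<lambda>(p, x). y x)"
      unfolding case_prod_unfold
      by (rule continuous_on_compose2[OF holomorphic_on_imp_continuous_on[OF y]]) (auto intro!: continuous_intros)
    then show "continuous_on (S (Suc j) \<times> {0..1}) (\<lambda>(z, \<tau>). rhs y (ray z \<tau>))"
      by (intro continuous_rhs_ray[where Z = "\<lambda>z. z" and h = "\<lambda>_. y"]) (use bd in auto)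
    fix \<tau> :: real assume \<tau>: "\<tau> \<in> {0..1}"
    show "(\<lambda>z. rhs y (ray z \<tau>)) holomorphic_on S (Suc j)"
    proof (cases "\<tau> = 1")
      case False
      have p: "(\<lambda>z. ray z \<tau>) holomorphic_on S (Suc j)" unfolding ray_def by (intro holomorphic_intros)
      have "rhs y holomorphic_on S (Suc j)"
      proof -
        have "(y \<circ> \<psi>) holomorphic_on S (Suc j)"
          by (rule holomorphic_on_compose_gen[OF holomorphic_on_subset[OF \<psi> S_subset_\<Omega>] y]) (use \<psi>_S in auto)
        then have "(\<Phi> \<circ> (y \<circ> \<psi>)) holomorphic_on S (Suc j)"
          by (rule holomorphic_on_compose_gen[OF _ \<Phi>]) auto
        then show ?thesis unfolding rhs_def o_def
          by (intro holomorphic_intros holomorphic_on_subset[OF a S_subset_\<Omega>] holomorphic_on_subset[OF b S_subset_\<Omega>])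
      qed
      from holomorphic_on_compose_gen[OF p this] show ?thesis
        using ray_in_S \<tau> False by (auto simp: o_def image_subset_iff)
    qed (simp add: ray_1 rhs_at_q1)
  qed
  then show ?thesis unfolding T_def
    using slit_S Gamma_pos by (intro holomorphic_intros) auto
qed

lemma T_contraction:
  assumes \<delta>: "0 < \<delta>" "\<delta> < 1"
    and y1: "y1 holomorphic_on S j" "\<And>x. x \<in> S j \<Longrightarrow> norm (y1 x) < R"
    and y2: "y2 holomorphic_on S j" "\<And>x. x \<in> S j \<Longrightarrow> norm (y2 x) < R"
    and close: "\<And>x. x \<in> S j \<Longrightarrow> norm (Moebius_function 0 (y1 x / of_real R) (y2 x / of_real R)) \<le> \<delta>"
    and z: "z \<in> S (Suc j)"
  shows "norm (Moebius_function 0 (T y1 z / of_real R) (T y2 z / of_real R)) \<le> 2 * \<theta> / (1 + \<theta>\<^sup>2) * \<delta>"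
proof (rule pseudo_hyperbolic_contraction[OF R \<theta> \<delta> _ _ y1(2) y2(2) close, where T = "\<lambda>y. T y z"])
  show "continuous_on (S j) y1" "continuous_on (S j) y2"
    using y1(1) y2(1) by (auto intro: holomorphic_on_imp_continuous_on)
  show "T y z = T y' z" if "\<And>x. x \<in> S j \<Longrightarrow> y x = y' x" for y y'
  proof -
    have "rhs y (ray z \<tau>) = rhs y' (ray z \<tau>)" if "\<tau> \<in> {0..1}" for \<tau>
    proof (cases "\<tau> = 1")
      case False
      then have "\<psi> (ray z \<tau>) \<in> S j" using that ray_in_S[OF z] \<psi>_S by auto
      then show ?thesis using \<open>\<And>x. x \<in> S j \<Longrightarrow> y x = y' x\<close> by (simp add: rhs_def)
    qed (simp add: ray_1 rhs_at_q1)
    then show ?thesis unfolding T_def by (metis (mono_tags, lifting) Henstock_Kurzweil_Integration.integral_cong)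
  qed
  fix h :: "complex \<Rightarrow> complex \<Rightarrow> complex"
  assume c: "continuous_on (ball 0 1 \<times> S j) (\<lambda>(\<zeta>, x). h \<zeta> x)"
    and hol: "\<And>x. x \<in> S j \<Longrightarrow> (\<lambda>\<zeta>. h \<zeta> x) holomorphic_on ball 0 1"
    and bd: "\<And>\<zeta> x. \<zeta> \<in> ball 0 1 \<Longrightarrow> x \<in> S j \<Longrightarrow> norm (h \<zeta> x) < R"
  have "(\<lambda>\<zeta>. integral {0..1} (\<lambda>\<tau>. rhs (h \<zeta>) (ray z \<tau>))) holomorphic_on ball 0 1"
  proof (rule holomorphic_on_integral_param)
    show "continuous_on (ball 0 1 \<times> {0..1}) (\<lambda>(\<zeta>, \<tau>). rhs (h \<zeta>) (ray z \<tau>))"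
      using continuous_rhs_ray[where Z = "\<lambda>_. z", OF _ _ c] z bd by (auto intro: less_imp_le)
    fix \<tau> :: real assume \<tau>: "\<tau> \<in> {0..1}"
    show "(\<lambda>\<zeta>. rhs (h \<zeta>) (ray z \<tau>)) holomorphic_on ball 0 1"
    proof (cases "\<tau> = 1")
      case False
      then have "\<psi> (ray z \<tau>) \<in> S j" using \<tau> ray_in_S[OF z] \<psi>_S by auto
      from holomorphic_on_compose_gen[OF hol[OF this] \<Phi>] show ?thesis
        unfolding rhs_def o_def by (auto intro!: holomorphic_intros)
    qed (simp add: ray_1 rhs_at_q1)
  qed simp
  then have "(\<lambda>\<zeta>. T (h \<zeta>) z) holomorphic_on ball 0 1"
    unfolding T_def using Gamma_pos by (intro holomorphic_intros) auto
  moreover have "norm (T (h \<zeta>) z) < \<theta> * R" if "\<zeta> \<in> ball 0 1" for \<zeta>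
    by (rule T_bound[OF z]) (use bd[OF that] in \<open>auto intro: less_imp_le\<close>)
  ultimately show "(\<lambda>\<zeta>. T (h \<zeta>) z) holomorphic_on ball 0 1 \<and> (\<forall>\<zeta>\<in>ball 0 1. norm (T (h \<zeta>) z) < \<theta> * R)" by blast
qed

definition Y :: "nat \<Rightarrow> complex \<Rightarrow> complex" where "Y j = (T ^^ j) (\<lambda>_. lam)"

lemma Y_simps: "Y 0 = (\<lambda>_. lam)" "Y (Suc j) = T (Y j)"
  by (auto simp: Y_def)

lemma Y_invariant: "Y j holomorphic_on S j \<and> (\<forall>x\<in>S j. norm (Y j x) < \<theta> * R)"
proof (induction j)
  case 0
  show ?case using lam_bound by (auto simp: Y_simps)
next
  case (Suc j)
  have "\<theta> * R \<le> 1 * R" by (rule mult_right_mono) (use \<theta> R in auto)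
  then have "norm (Y j x) \<le> R" if "x \<in> S j" for x using Suc that by force
  then show ?case using Suc T_holomorphic[of "Y j" j] T_bound[of _ j "Y j"] by (auto simp: Y_simps)
qed

lemma Y_holomorphic: "Y j holomorphic_on S j"
  using Y_invariant by blast

lemma Y_bound: "x \<in> S j \<Longrightarrow> norm (Y j x) < \<theta> * R"
  using Y_invariant by blast

lemma Y_bound_R: "x \<in> S j \<Longrightarrow> norm (Y j x) < R"
  by (rule less_le_trans[OF Y_bound]) (use \<theta> R in auto)

definition \<kappa> :: real where "\<kappa> = 2 * \<theta> / (1 + \<theta>\<^sup>2)"

lemma \<kappa>: "0 < \<kappa>" "\<kappa> < 1"
proof -
  have "0 < (1 - \<theta>)\<^sup>2" using \<theta> by simp
  then have "2 * \<theta> < 1 + \<theta>\<^sup>2" by (simp add: power2_eq_square algebra_simps)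
  moreover have "0 < 1 + \<theta>\<^sup>2" by (simp add: add_pos_nonneg)
  ultimately show "\<kappa> < 1" "0 < \<kappa>" using \<theta> by (auto simp: \<kappa>_def divide_less_eq_1)
qed

text \<open>The exponent counts the applications of \<open>T\<close>; the first factor \<open>\<kappa>\<close> comes from the two initial iterates
having values in the disc of radius \<open>\<theta> R\<close>.\<close>

lemma Y_close: "z \<in> S (Suc j) \<Longrightarrow> norm (Moebius_function 0 (Y j z / of_real R) (Y (Suc j) z / of_real R)) \<le> \<kappa> ^ Suc j"
proof (induction j arbitrary: z)
  case 0
  have z0: "z \<in> S 0" using 0 S_Suc by blast
  have n: "norm (w / of_real R) \<le> \<theta> \<and> norm (w / of_real R / of_real \<theta>) < 1" if "norm w < \<theta> * R" for w :: complex
    using that R \<theta> by (auto simp: norm_divide norm_mult divide_less_eq divide_le_eq less_imp_le mult.assoc mult.commute)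
  note n0 = n[OF Y_bound[OF z0]] and n1 = n[OF Y_bound[OF 0]]
  have "norm (Moebius_function 0 (Y 0 z / of_real R) (Y (Suc 0) z / of_real R))
     \<le> \<kappa> * norm (Moebius_function 0 (Y 0 z / of_real R / of_real \<theta>) (Y (Suc 0) z / of_real R / of_real \<theta>))"
    unfolding \<kappa>_def by (rule Moebius_small_disc[OF \<theta>]) (use n0 n1 in auto)
  also have "\<dots> \<le> \<kappa> * 1"
    by (rule mult_left_mono[OF less_imp_le[OF Moebius_function_norm_lt_1]]) (use n0 n1 \<kappa> in auto)
  finally show ?case by simp
next
  case (Suc j)
  have "norm (Moebius_function 0 (T (Y j) z / of_real R) (T (Y (Suc j)) z / of_real R)) \<le> 2 * \<theta> / (1 + \<theta>\<^sup>2) * \<kappa> ^ Suc j"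
  proof (rule T_contraction[of _ "Y j" "Suc j"])
    show "0 < \<kappa> ^ Suc j" "\<kappa> ^ Suc j < 1" using \<kappa> power_Suc_less_one[of \<kappa> j] by auto
    show "Y j holomorphic_on S (Suc j)" using holomorphic_on_subset[OF Y_holomorphic S_Suc] .
    show "Y (Suc j) holomorphic_on S (Suc j)" by (rule Y_holomorphic)
    show "norm (Y j x) < R" "norm (Y (Suc j) x) < R" if "x \<in> S (Suc j)" for x
      using that Y_bound_R S_Suc by blast+
  qed (use Suc in auto)
  then show ?case by (simp add: Y_simps(2) \<kappa>_def)
qed

lemma Y_diff: 
  assumes "z \<in> S (Suc j)" shows "norm (Y (Suc j) z - Y j z) \<le> 2 * R * \<kappa> ^ j"
proof -
  have "norm (Y (Suc j) z - Y j z) \<le> 2 * R * \<kappa> ^ Suc j"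
    by (rule norm_diff_le_Moebius[OF _ _ Y_close[OF assms]]) (use assms S_Suc Y_bound_R in blast)+
  also have "\<dots> \<le> 2 * R * \<kappa> ^ j" using R \<kappa> by (intro mult_left_mono power_decreasing) auto
  finally show ?thesis .
qed

lemma \<psi>_interior:
  assumes t: "t \<in> {q1<..q2}"
  shows "\<exists>s\<in>{q1<..q2}. \<psi> (of_real t) = of_real s"
proof (rule real_if_in_all_sectors[OF _ r_tendsto_0])
  show "\<psi> (of_real t) \<in> sector q1 q2 (r n)" if "n \<ge> 0" for n
    using \<psi>_S[OF real_in_S[OF t]] by (simp add: S_def)
qed (use r_pos r_le_pi in auto)

lemma \<psi>_interval:
  assumes t: "t \<in> {q1..q2}"
  shows "\<exists>s\<in>{q1..q2}. \<psi> (of_real t) = of_real s"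
proof -
  have cl: "closure {q1<..q2} = {q1..q2}" using q by simp
  have "continuous_on (of_real ` {q1..q2}) \<psi>"
    using holomorphic_on_imp_continuous_on[OF \<psi>] \<Omega>(2) by (rule continuous_on_subset)
  then have "continuous_on {q1..q2} (\<lambda>t. \<psi> (of_real t))"
    by (intro continuous_on_compose2[of _ \<psi> _ of_real]) (auto intro!: continuous_intros)
  moreover have "closed (complex_of_real ` {q1..q2})"
    by (intro compact_imp_closed compact_continuous_image continuous_intros) auto
  moreover have "(\<lambda>t. \<psi> (of_real t)) ` {q1<..q2} \<subseteq> complex_of_real ` {q1..q2}"
    using \<psi>_interior by fastforce
  ultimately have "(\<lambda>t. \<psi> (of_real t)) ` {q1..q2} \<subseteq> complex_of_real ` {q1..q2}"
    using image_closure_subset[of "{q1<..q2}" "\<lambda>t. \<psi> (of_real t)"] unfolding cl by blast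
  then have "\<psi> (of_real t) \<in> complex_of_real ` {q1..q2}" using t by (auto simp: image_subset_iff)
  then show ?thesis by blast
qed

theorem solution_exists:
  "\<exists>u. solves_fde q1 q2 \<alpha> a b \<Phi> \<psi> u \<and> u \<in> gevrey_bound k q1 q2 \<and> u q1 = lam"
proof -
  let ?I = "{q1<..q2}"
  \<comment> \<open>the derivatives of the solution, as a telescoping series\<close>
  define U where "U m t = (\<Sum>j. (deriv ^^ m) (\<lambda>z. Y (Suc j) z - Y j z) (complex_of_real t))" for m t
  have SN: "sector_seq q1 q2 k D (Suc N + j) = S (Suc j)" "sector_seq q1 q2 k D (Suc (Suc N) + j) = S (Suc (Suc j))" for j
    by (simp_all add: S_eq)
  have Uhol: "(\<lambda>z. Y (Suc j) z - Y j z) holomorphic_on sector_seq q1 q2 k D (Suc N + j)" for j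
    unfolding SN by (intro holomorphic_intros Y_holomorphic holomorphic_on_subset[OF Y_holomorphic S_Suc])
  have Ubd: "norm (Y (Suc j) z - Y j z) \<le> 2 * R * \<kappa> ^ j" if "z \<in> sector_seq q1 q2 k D (Suc N + j)" for j z
    using that Y_diff unfolding SN by blast
  note Ulem = holomorphic_series_on_shrinking_sectors[OF q k D _ \<kappa> Uhol Ubd, folded U_def, simplified]
  have Usums: "(\<lambda>j. Y (Suc j) (of_real t) - Y j (of_real t)) sums U 0 t" if "t \<in> ?I" for t
    using Ulem(1) that by simp
  have Uder: "(U m has_vector_derivative U (Suc m) t) (at t within ?I)" if "t \<in> ?I" for m t
    using Ulem(2) that by simp
  obtain A B where AB: "A > 0" "B > 0" and UAB: "\<And>m t. t \<in> ?I \<Longrightarrow>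
      norm (U m t) \<le> A * fact m * (real m ^ m) powr (1 / k) * (B / (t - q1)) ^ m"
    using Ulem(3) by (metis greaterThanAtMost_iff)
  define u where "u t = (if t = q1 then lam else lam + U 0 t)" for t
  have Ylim: "(\<lambda>n. Y n (of_real t)) \<longlonglongrightarrow> u t" if t: "t \<in> ?I" for t
    using LIMSEQ_telescoping[OF Usums[OF t]] t by (simp add: u_def Y_simps(1))

  obtain B\<Phi> where B\<Phi>: "B\<Phi> > 0" "\<And>x y. x \<in> cball 0 R \<Longrightarrow> y \<in> cball 0 R \<Longrightarrow> norm (\<Phi> x - \<Phi> y) \<le> B\<Phi> * norm (x - y)"
    using holomorphic_Lipschitz_on_compact_convex[OF \<Phi>, of "cball 0 R"] by auto
  \<comment> \<open>the same telescoping for \<open>\<Phi> \<circ> Y \<circ> \<psi>\<close>, to control the derivative of the right-hand side near \<open>q1\<close>\<close>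
  define g where "g j z = \<Phi> (Y (Suc j) (\<psi> z)) - \<Phi> (Y j (\<psi> z))" for j z
  define V where "V m t = (\<Sum>j. (deriv ^^ m) (g j) (complex_of_real t))" for m t
  have hol\<Phi>: "(\<lambda>z. \<Phi> (Y j (\<psi> z))) holomorphic_on S (Suc j)" for j
  proof -
    have "(Y j \<circ> \<psi>) holomorphic_on S (Suc j)"
      by (rule holomorphic_on_compose_gen[OF holomorphic_on_subset[OF \<psi> S_subset_\<Omega>] Y_holomorphic]) (use \<psi>_S in auto)
    from holomorphic_on_compose_gen[OF this \<Phi>] show ?thesis by (simp add: o_def)
  qed
  have Vhol: "g j holomorphic_on sector_seq q1 q2 k D (Suc (Suc N) + j)" for j
    unfolding SN g_def by (intro holomorphic_intros hol\<Phi> holomorphic_on_subset[OF hol\<Phi> S_Suc])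
  have Vbd: "norm (g j z) \<le> (B\<Phi> * (2 * R)) * \<kappa> ^ j" if "z \<in> sector_seq q1 q2 k D (Suc (Suc N) + j)" for j z
  proof -
    have p: "\<psi> z \<in> S (Suc j)" "\<psi> z \<in> S j" using that S_Suc \<psi>_S unfolding SN by blast+
    have "norm (g j z) \<le> B\<Phi> * norm (Y (Suc j) (\<psi> z) - Y j (\<psi> z))"
      unfolding g_def by (rule B\<Phi>(2)) (use Y_bound_R[OF p(1)] Y_bound_R[OF p(2)] in auto)
    also have "\<dots> \<le> B\<Phi> * (2 * R * \<kappa> ^ j)" by (rule mult_left_mono[OF Y_diff[OF p(1)]]) (use B\<Phi> in auto)
    finally show ?thesis by (simp add: mult.assoc)
  qed
  note Vlem = holomorphic_series_on_shrinking_sectors[OF q k D _ \<kappa> Vhol Vbd, folded V_def, simplified]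
  have Vsums: "(\<lambda>j. g j (of_real t)) sums V 0 t" if "t \<in> ?I" for t
    using Vlem(1) that by simp
  have Vder: "(V m has_vector_derivative V (Suc m) t) (at t within ?I)" if "t \<in> ?I" for m t
    using Vlem(2) that by simp
  obtain A' B' where AB': "A' > 0" "B' > 0" and VAB: "\<And>m t. t \<in> ?I \<Longrightarrow>
      norm (V m t) \<le> A' * fact m * (real m ^ m) powr (1 / k) * (B' / (t - q1)) ^ m"
    using Vlem(3) by (metis greaterThanAtMost_iff)
  define G where "G t = \<Phi> lam + V 0 t" for t
  have Glim: "(\<lambda>n. \<Phi> (Y n (\<psi> (of_real t)))) \<longlonglongrightarrow> G t" if t: "t \<in> ?I" for t
    using LIMSEQ_telescoping[OF Vsums[OF t, unfolded g_def]] t by (simp add: G_def Y_simps(1))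
  have Gu: "G t = \<Phi> (u s)" if "t \<in> ?I" "s \<in> ?I" "\<psi> (of_real t) = of_real s" for t s
  proof (rule LIMSEQ_unique[OF Glim[OF that(1)]])
    have "isCont \<Phi> (u s)" 
      by (metis UNIV_I \<Phi> continuous_on_eq_continuous_at holomorphic_on_imp_continuous_on open_UNIV)
    from isCont_tendsto_compose[OF this Ylim[OF that(2)]]
    show "(\<lambda>n. \<Phi> (Y n (\<psi> (of_real t)))) \<longlonglongrightarrow> \<Phi> (u s)" by (simp add: that)
  qed
  define F where "F t = a (of_real t) * G t + b (of_real t)" for t
  have F0: "F q1 = 0" by (simp add: F_def a0 b0)
  have Gbd: "norm (G t) \<le> norm (\<Phi> lam) + A'" if "t \<in> ?I" for t
    using norm_triangle_ineq[of "\<Phi> lam" "V 0 t"] VAB[OF that, of 0] by (simp add: G_def)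
  have Gder: "(G has_vector_derivative V 1 t) (at t within ?I)" if "t \<in> ?I" for t
  proof -
    have "((\<lambda>t. \<Phi> lam + V 0 t) has_vector_derivative 0 + V (Suc 0) t) (at t within ?I)"
      by (intro has_vector_derivative_add has_vector_derivative_const Vder that)
    then show ?thesis by (simp add: G_def[abs_def])
  qed
  have contG: "continuous_on ?I G" "continuous_on ?I (V 1)"
    by (rule continuous_on_vector_derivative, erule Gder) (rule continuous_on_vector_derivative, erule Vder)
  have K: "compact (complex_of_real ` {q1..q2})" "convex (complex_of_real ` {q1..q2})"
    by (intro compact_continuous_image continuous_intros compact_Icc)
       (intro convex_linear_image bounded_linear.linear bounded_linear_of_real convex_real_interval)
  have cont_real: "continuous_on {q1..q2} (\<lambda>t. f (complex_of_real t))" if "f holomorphic_on \<Omega>" for f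
    by (rule continuous_on_compose2[OF holomorphic_on_imp_continuous_on[OF that]]) (use \<Omega>(2) in \<open>auto intro!: continuous_intros\<close>)
  have contF: "continuous_on {q1..q2} F"
  proof -
    have "continuous_on {q1..q2} (\<lambda>t. a (of_real t) * G t)"
    proof (rule continuous_on_mult_vanishing[OF cont_real[OF a] _ contG(1)])
      show "openin (top_of_set {q1..q2}) ?I" unfolding openin_open by (rule exI[of _ "{q1<..}"]) auto
      show "a (of_real t) = 0" if "t \<in> {q1..q2} - ?I" for t using that a0 by (cases "t = q1") auto
    qed (rule Gbd)
    then show ?thesis unfolding F_def[abs_def] by (intro continuous_on_add cont_real[OF b])
  qed
  define P where "P t = a (of_real t) * V 1 t + deriv a (of_real t) * G t + deriv b (of_real t)" for t
  have real_der: "((\<lambda>t. f (complex_of_real t)) has_vector_derivative deriv f (of_real t)) (at t within X)"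
    if "f holomorphic_on \<Omega>" "t \<in> {q1..q2}" for f t X
    by (rule has_vector_derivative_real_field[OF holomorphic_derivI[OF that(1) \<Omega>(1)]]) (use \<Omega>(2) that in auto)
  have Fder: "(F has_vector_derivative P t) (at t)" if t: "t \<in> {q1<..<q2}" for t
  proof -
    have tI: "t \<in> ?I" using t by auto
    have "(F has_vector_derivative P t) (at t within ?I)"
      unfolding F_def[abs_def] P_def
      by (intro has_vector_derivative_add has_vector_derivative_mult real_der[OF a] real_der[OF b] Gder tI) (use tI in auto)
    moreover have "at t within ?I = at t"
      by (rule at_within_nhd[of _ "{q1<..<q2}"]) (use t in auto)
    ultimately show ?thesis by simp
  qed
  have contP: "continuous_on ?I P"
  proof -
    have "continuous_on ?I (\<lambda>t. f (complex_of_real t))" if "f holomorphic_on \<Omega>" for f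
      by (rule continuous_on_subset[OF cont_real[OF that]]) auto
    then show ?thesis unfolding P_def[abs_def]
      by (intro continuous_intros contG) (use a b holomorphic_deriv \<Omega>(1) in auto)
  qed
  \<comment> \<open>the bound \<open>a = O(t - q1)\<close> cancels the singularity of \<open>V 1\<close>\<close>
  obtain Ba where Ba: "Ba > 0" "\<And>x y. x \<in> complex_of_real ` {q1..q2} \<Longrightarrow> y \<in> complex_of_real ` {q1..q2} \<Longrightarrow> norm (a x - a y) \<le> Ba * norm (x - y)"
    using holomorphic_Lipschitz_on_compact_convex[OF a \<Omega>(1) K \<Omega>(2)] by blast
  obtain B1 where B1: "B1 > 0" "\<And>t. t \<in> {q1..q2} \<Longrightarrow> norm (deriv a (of_real t)) \<le> B1"
    using compact_bound[OF compact_Icc cont_real[OF holomorphic_deriv[OF a \<Omega>(1)]]] by blast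
  obtain B2 where B2: "B2 > 0" "\<And>t. t \<in> {q1..q2} \<Longrightarrow> norm (deriv b (of_real t)) \<le> B2"
    using compact_bound[OF compact_Icc cont_real[OF holomorphic_deriv[OF b \<Omega>(1)]]] by blast
  have Pbd: "norm (P t) \<le> Ba * (A' * B') + B1 * (norm (\<Phi> lam) + A') + B2" if t: "t \<in> ?I" for t
  proof -
    have "norm (a (of_real t)) \<le> Ba * (t - q1)"
      using Ba(2)[of "of_real t" "of_real q1"] t q a0 by (simp flip: of_real_diff)
    moreover have "norm (V 1 t) \<le> A' * (B' / (t - q1))" using VAB[OF t, of 1] by simp
    ultimately have "norm (a (of_real t)) * norm (V 1 t) \<le> (Ba * (t - q1)) * (A' * (B' / (t - q1)))"
      by (rule mult_mono) (use Ba t in auto)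
    also have "\<dots> = Ba * (A' * B')" using t by simp
    finally have 1: "norm (a (of_real t) * V 1 t) \<le> Ba * (A' * B')" by (simp add: norm_mult)
    have 2: "norm (deriv a (of_real t) * G t) \<le> B1 * (norm (\<Phi> lam) + A')"
      unfolding norm_mult by (rule mult_mono) (use B1 Gbd t in auto)
    have 3: "norm (deriv b (of_real t)) \<le> B2" using B2 t by auto
    show ?thesis unfolding P_def by (intro norm_triangle_le add_mono 1 2 3)
  qed
  have ray_real: "ray (of_real t) \<tau> = of_real (q1 + (1 - \<tau> powr (1 / \<alpha>)) * (t - q1))" for t \<tau>
    by (simp add: ray_def)
  have ueq: "u t = lam + of_real ((t - q1) powr \<alpha> / Gamma (\<alpha> + 1)) *
      integral {0..1} (\<lambda>\<tau>. F (q1 + (1 - \<tau> powr (1 / \<alpha>)) * (t - q1)))" if t: "t \<in> {q1..q2}" for t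
  proof (cases "t = q1")
    case False
    with t have tI: "t \<in> ?I" by auto
    let ?s = "\<lambda>\<tau>. q1 + (1 - \<tau> powr (1 / \<alpha>)) * (t - q1)"
    have sI: "?s \<tau> \<in> ?I" if "\<tau> \<in> {0..<1}" for \<tau>
    proof -
      have "\<tau> powr (1 / \<alpha>) < 1 powr (1 / \<alpha>)" by (rule powr_less_mono2) (use that \<alpha> in auto)
      then have "0 < (1 - \<tau> powr (1 / \<alpha>)) * (t - q1)" using tI by simp
      moreover have "q1 + (1 - \<tau> powr (1 / \<alpha>)) * (t - q1) \<le> q1 + 1 * (t - q1)"
        by (intro add_left_mono mult_right_mono) (use tI in auto)
      ultimately show ?thesis using tI by simp
    qed
    have lim: "(\<lambda>n. integral {0..1} (\<lambda>\<tau>. rhs (Y n) (ray (of_real t) \<tau>))) \<longlonglongrightarrow> integral {0..1} (\<lambda>\<tau>. F (?s \<tau>))"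
    proof (rule dominated_convergence(2)[where h = "\<lambda>_. Q"])
      show "(\<lambda>\<tau>. rhs (Y n) (ray (of_real t) \<tau>)) integrable_on {0..1}" for n
      proof (rule integrable_continuous_real)
        have "continuous_on ({0::real} \<times> S n) (\<lambda>(p, x). Y n x)"
          unfolding case_prod_unfold
          by (rule continuous_on_compose2[OF holomorphic_on_imp_continuous_on[OF Y_holomorphic]]) (auto intro!: continuous_intros)
        then have "continuous_on ({0::real} \<times> {0..1}) (\<lambda>(p, \<tau>). rhs (Y n) (ray (of_real t) \<tau>))"
          by (intro continuous_rhs_ray[where Z = "\<lambda>_. of_real t" and h = "\<lambda>_. Y n" and j = n])
             (use real_in_S[OF tI] Y_bound_R in \<open>auto intro: less_imp_le\<close>)
        then have "continuous_on {0..1} (\<lambda>\<tau>. (\<lambda>(p, \<tau>). rhs (Y n) (ray (of_real t) \<tau>)) (0::real, \<tau>))"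
          by (rule continuous_on_compose2) (auto intro!: continuous_intros)
        then show "continuous_on {0..1} (\<lambda>\<tau>. rhs (Y n) (ray (of_real t) \<tau>))" by simp
      qed
      show "norm (rhs (Y n) (ray (of_real t) \<tau>)) \<le> Q" if "\<tau> \<in> {0..1}" for n \<tau>
        by (rule rhs_ray_bound[OF real_in_S[OF tI] _ that, of n]) (use Y_bound_R in \<open>auto intro: less_imp_le\<close>)
      show "(\<lambda>n. rhs (Y n) (ray (of_real t) \<tau>)) \<longlonglongrightarrow> F (?s \<tau>)" if "\<tau> \<in> {0..1}" for \<tau>
      proof (cases "\<tau> = 1")
        case True
        then show ?thesis using rhs_at_q1 F0 by (simp add: ray_1)
      next
        case False
        then show ?thesis unfolding ray_real rhs_def F_def
          by (intro tendsto_intros Glim sI) (use that in auto)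
      qed
    qed auto
    have "(\<lambda>n. T (Y n) (of_real t)) \<longlonglongrightarrow> lam + of_real ((t - q1) powr \<alpha> / Gamma (\<alpha> + 1)) * integral {0..1} (\<lambda>\<tau>. F (?s \<tau>))"
    proof -
      have "complex_of_real (t - q1) powr of_real \<alpha> = of_real ((t - q1) powr \<alpha>)"
        by (rule powr_of_real) (use tI in auto)
      then have "(complex_of_real t - of_real q1) powr of_real \<alpha> / of_real (Gamma (\<alpha> + 1)) = of_real ((t - q1) powr \<alpha> / Gamma (\<alpha> + 1))"
        by simp
      then show ?thesis unfolding T_def by (simp only:) (intro tendsto_intros lim)
    qed
    moreover have "(\<lambda>n. T (Y n) (of_real t)) \<longlonglongrightarrow> u t"
      using LIMSEQ_Suc[OF Ylim[OF tI]] by (simp add: Y_simps(2))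
    ultimately show ?thesis by (metis LIMSEQ_unique)
  qed (simp add: u_def)
  obtain h where contg: "continuous_on {q1..q2} h"
    and du: "\<And>t. t \<in> {q1..q2} \<Longrightarrow> (u has_vector_derivative h t) (at t within {q1..q2})"
    and cap: "\<And>t. t \<in> {q1..q2} \<Longrightarrow> caputo q1 \<alpha> u t = F t"
    using caputo_fractional_integral[OF \<alpha> q contF F0 Fder contP Pbd ueq] by blast
  have nt: "at t within {q1..q2} \<noteq> bot" if "t \<in> {q1..q2}" for t
  proof (cases "t = q1")
    case True
    then show ?thesis using q by (intro at_within_interval_neq_bot[of "t - 1" t _ q2]) auto
  next
    case False
    then show ?thesis using that by (intro at_within_interval_neq_bot[of q1 t _ "t + 1"]) auto
  qed
  have "Ck_on 1 {q1..q2} u"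
  proof -
    have "nth_deriv_on {q1..q2} 1 u t = h t" if "t \<in> {q1..q2}" for t
      using vector_derivative_within[OF nt[OF that] du[OF that]] by (simp add: nth_deriv_on_def)
    then have "continuous_on {q1..q2} (nth_deriv_on {q1..q2} 1 u)"
      using contg continuous_on_cong[of "{q1..q2}" "{q1..q2}" "nth_deriv_on {q1..q2} 1 u" h] by blast
    moreover have "u differentiable (at t within {q1..q2})" if "t \<in> {q1..q2}" for t
      using du[OF that] by (rule differentiableI_vector)
    ultimately show ?thesis by (simp add: Ck_on_def nth_deriv_on_def)
  qed
  then have "u \<in> gevrey_bound k q1 q2"
  proof (rule gevrey_boundI[OF q])
    let ?W = "\<lambda>m t. (if m = 0 then lam else 0) + U m t"
    show "(?W m has_vector_derivative ?W (Suc m) t) (at t within ?I)" if "t \<in> ?I" for m t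
      using has_vector_derivative_add[OF has_vector_derivative_const Uder[OF that]] by simp
    show "u t = ?W 0 t" if "t \<in> ?I" for t using that by (simp add: u_def)
    show "0 < norm lam + A" "0 < B" using AB by (auto simp: add_nonneg_pos)
    show "norm (?W m t) \<le> (norm lam + A) * fact m * (real m ^ m) powr (1 / k) * (B / (t - q1)) ^ m" if "t \<in> ?I" for m t
    proof (cases "m = 0")
      case True
      then show ?thesis using norm_triangle_ineq[of lam "U 0 t"] UAB[OF that, of 0] by simp
    next
      case False
      have "norm (U m t) \<le> A * (fact m * (real m ^ m) powr (1 / k) * (B / (t - q1)) ^ m)"
        using UAB[OF that, of m] by (simp add: mult.assoc)
      also have "\<dots> \<le> (norm lam + A) * (fact m * (real m ^ m) powr (1 / k) * (B / (t - q1)) ^ m)"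
        by (rule mult_right_mono) (use AB that in auto)
      finally show ?thesis using False by (simp add: mult.assoc)
    qed
  qed
  moreover have "solves_fde q1 q2 \<alpha> a b \<Phi> \<psi> u"
    unfolding solves_fde_def
  proof
    fix t assume t: "t \<in> {q1..q2}"
    show "\<exists>s\<in>{q1..q2}. \<psi> (of_real t) = of_real s \<and> caputo q1 \<alpha> u t = a (of_real t) * \<Phi> (u s) + b (of_real t)"
    proof (cases "t = q1")
      case True
      obtain s where "s \<in> {q1..q2}" "\<psi> (of_real t) = of_real s" using \<psi>_interval[OF t] by blast
      then show ?thesis using cap[OF t] F0 True a0 b0 by (intro bexI[of _ s]) auto
    next
      case False
      with t have tI: "t \<in> ?I" by auto
      obtain s where s: "s \<in> ?I" "\<psi> (of_real t) = of_real s" using \<psi>_interior[OF tI] by blast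
      then show ?thesis using cap[OF t] Gu[OF tI s] by (intro bexI[of _ s]) (auto simp: F_def)
    qed
  qed
  moreover have "u q1 = lam" by (simp add: u_def)
  ultimately show ?thesis by blast
qed

end

section \<open>Sectors inside a neighbourhood of the interval\<close>

lemma nbhd_eq: "nbhd q1 q2 r = (\<Union>t\<in>{q1..q2}. ball (complex_of_real t) r)"
proof (intro equalityI subsetI)
  fix z assume "z \<in> nbhd q1 q2 r"
  then obtain t \<zeta> where "z = of_real t + \<zeta>" "t \<in> {q1..q2}" "norm \<zeta> < r" by (auto simp: nbhd_def)
  then show "z \<in> (\<Union>t\<in>{q1..q2}. ball (complex_of_real t) r)" by (intro UN_I[of t]) (auto simp: dist_norm)
next
  fix z assume "z \<in> (\<Union>t\<in>{q1..q2}. ball (complex_of_real t) r)"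
  then obtain t where "t \<in> {q1..q2}" "norm (z - of_real t) < r" by (auto simp: dist_norm norm_minus_commute)
  moreover have "z = of_real t + (z - of_real t)" by simp
  ultimately show "z \<in> nbhd q1 q2 r" unfolding nbhd_def by blast
qed

lemma sup_norm_upper:
  assumes "compact K" "continuous_on K f" "x \<in> K"
  shows "norm (f x) \<le> sup_norm K f"
proof -
  have "compact ((\<lambda>z. norm (f z)) ` K)"
    by (intro compact_continuous_image continuous_intros assms)
  then have "bdd_above ((\<lambda>z. norm (f z)) ` K)" by (intro bounded_imp_bdd_above compact_imp_bounded)
  then show ?thesis unfolding sup_norm_def by (intro cSUP_upper assms)
qed

lemma sector_subset_open:
  assumes W: "open W" "complex_of_real ` {q1..q2} \<subseteq> W" and q: "q1 < q2"
  obtains e where "e > 0" "\<And>D. 0 < D \<Longrightarrow> D \<le> e \<Longrightarrow> sector q1 q2 D \<subseteq> W"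
proof -
  have "compact (complex_of_real ` {q1..q2})" by (intro compact_continuous_image continuous_intros compact_Icc)
  then obtain d where d: "d > 0" "(\<Union>z\<in>complex_of_real ` {q1..q2}. ball z d) \<subseteq> W"
    using compact_subset_open_imp_ball_epsilon_subset[OF _ W] by blast
  define e where "e = min 1 (d / (q2 - q1 + 2))"
  have e: "e > 0" using d q by (simp add: e_def)
  moreover have "sector q1 q2 D \<subseteq> W" if D: "0 < D" "D \<le> e" for D
  proof
    fix z assume "z \<in> sector q1 q2 D"
    from sector_near_segment[OF this q D(1)] obtain t where t: "t \<in> {q1..q2}" "dist (of_real t) z < D * (q2 - q1 + D) + D" by blast
    have "D \<le> 1" "D \<le> d / (q2 - q1 + 2)" using D by (auto simp: e_def)
    then have "D * (q2 - q1 + 2) \<le> d" using q by (simp add: pos_le_divide_eq)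
    moreover have "D * (q2 - q1 + D) + D = D * (q2 - q1 + D + 1)" by (simp add: algebra_simps)
    moreover have "D * (q2 - q1 + D + 1) \<le> D * (q2 - q1 + 2)" by (rule mult_left_mono) (use \<open>D \<le> 1\<close> D in auto)
    ultimately show "z \<in> W" using t d(2) by (fastforce simp: subset_iff)
  qed
  ultimately show ?thesis by (rule that)
qed

section \<open>The existence theorem\<close>

theorem mainTheorem1:
  fixes k \<alpha> \<sigma> \<alpha>0 \<beta>0 L :: real and lam :: complex
    and a b \<psi> \<Phi> :: "complex \<Rightarrow> complex"
  assumes "k > 0" and "0 < \<alpha>" and "\<alpha> < 1" and "\<sigma> > 0"
    and "a holomorphic_on nbhd (-1) 1 \<sigma>"
    and "b holomorphic_on nbhd (-1) 1 \<sigma>"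
    and "\<psi> holomorphic_on nbhd (-1) 1 \<sigma>"
    and "\<Phi> holomorphic_on UNIV"
    and "\<exists>z\<in>nbhd (-1) 1 \<sigma>. a z \<noteq> 0"
    and "\<alpha>0 > 0" and "\<beta>0 > 0"
    and "\<And>z. norm (\<Phi> z) \<le> \<alpha>0 * exp (\<beta>0 * norm z)"
    and "property_S k (-1) 1 \<psi>"
    and "L = 1 / \<beta>0 *
           ln (\<alpha> * Gamma \<alpha> / (\<alpha>0 * \<beta>0 * 2 powr \<alpha> * sup_norm (real_segment (-1) 1) a))"
    and "a (-1) = 0" and "b (-1) = 0"
    and "2 powr \<alpha> / (\<alpha> * Gamma \<alpha>) * sup_norm (real_segment (-1) 1) b + norm lam
         < 1 / \<beta>0 *
           ln (\<alpha> * Gamma \<alpha> / (exp 1 * \<alpha>0 * \<beta>0 * 2 powr \<alpha> * sup_norm (real_segment (-1) 1) a))"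
    and "sup_norm (real_segment (-1) 1) a * sup_norm (real_segment (-L) L) \<Phi>
           + sup_norm (real_segment (-1) 1) b < 1"
    and "sup_norm (real_segment (-1) 1) a * sup_norm (real_segment (-L) L) (deriv \<Phi>)
         < \<alpha> * Gamma \<alpha> / 2 powr \<alpha>"
    and "sup_norm (real_segment (-1) 1) (deriv \<psi>) \<le> 1 + \<alpha>"
  shows "\<exists>u. solves_fde (-1) 1 \<alpha> a b \<Phi> \<psi> u \<and> u \<in> gevrey_bound k (-1) 1 \<and> u (-1) = lam"
proof -
  note k = \<open>k > 0\<close> and \<alpha> = \<open>0 < \<alpha>\<close> \<open>\<alpha> < 1\<close> and a_hol = assms(5) and b_hol = assms(6) and \<psi>_hol = assms(7)
    and \<alpha>0 = \<open>\<alpha>0 > 0\<close> and \<beta>0 = \<open>\<beta>0 > 0\<close> and growth = assms(12) and S = assms(13) and L = assms(14) and small = assms(17)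
  let ?\<Omega> = "nbhd (-1) 1 \<sigma>" and ?K = "real_segment (-1) 1"
  define A B where "A = sup_norm ?K a" and "B = sup_norm ?K b"
  have \<Omega>: "open ?\<Omega>" unfolding nbhd_eq by auto
  have K\<Omega>: "?K \<subseteq> ?\<Omega>" unfolding nbhd_eq real_segment_def using \<open>\<sigma> > 0\<close> by auto
  have K: "compact ?K" unfolding real_segment_def by (intro compact_continuous_image continuous_intros compact_Icc)
  have cont: "continuous_on ?\<Omega> a" "continuous_on ?\<Omega> b" using a_hol b_hol by (auto intro: holomorphic_on_imp_continuous_on)
  have AB: "norm (a z) \<le> A" "norm (b z) \<le> B" if "z \<in> ?K" for z
    unfolding A_def B_def using cont K\<Omega> that by (auto intro!: sup_norm_upper[OF K] intro: continuous_on_subset)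
  have m1: "-1 \<in> ?K" unfolding real_segment_def by force
  have A0: "A \<ge> 0" and B0: "B \<ge> 0" using AB[OF m1] by (auto intro: order_trans[OF norm_ge_zero])
  define H where "H = Gamma (\<alpha> + 1)"
  have H: "\<alpha> * Gamma \<alpha> = H" "H > 0"
  proof -
    have "\<alpha> \<notin> \<int>\<^sub>\<le>\<^sub>0" using \<alpha> by (auto elim!: nonpos_Ints_cases)
    then show "\<alpha> * Gamma \<alpha> = H" unfolding H_def by (simp add: Gamma_plus1)
    show "H > 0" unfolding H_def using \<alpha> by (intro Gamma_real_pos) auto
  qed
  define X where "X = H / (\<alpha>0 * \<beta>0 * 2 powr \<alpha> * A)"
  have small': "2 powr \<alpha> / H * B + norm lam < 1 / \<beta>0 * ln (X / exp 1)"
    using small unfolding H A_def[symmetric] B_def[symmetric] X_def by (simp add: mult_ac)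
  have "0 \<le> 2 powr \<alpha> / H * B + norm lam" using H B0 by simp
  then have "0 < ln (X / exp 1)" using small' \<beta>0 by (smt (verit) divide_pos_pos mult_nonneg_nonpos zero_less_one)
  \<comment> \<open>for \<open>A = 0\<close> the argument of the logarithm is 0 and \<open>ln 0 = 0\<close>, contradicting positivity\<close>
  then have "A \<noteq> 0" by (auto simp: X_def)
  then have Apos: "A > 0" using A0 by simp
  then have X: "X > 0" unfolding X_def using H \<alpha>0 \<beta>0 by simp
  have LX: "L = ln X / \<beta>0" unfolding L H A_def[symmetric] X_def by simp
  define M where "M = \<alpha>0 * exp (\<beta>0 * L)"
  have MX: "M = \<alpha>0 * X" using X \<beta>0 by (simp add: M_def LX)
  have AM: "2 powr \<alpha> / H * (A * M) = 1 / \<beta>0"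
    unfolding MX X_def using Apos H \<alpha>0 \<beta>0 by simp
  have "ln (X / exp 1) = ln X - 1" using X by (simp add: ln_div)
  with small' have lt: "norm lam + 2 powr \<alpha> / H * (A * M + B) < L"
    using AM by (simp add: LX ring_distribs diff_divide_distrib)
  \<comment> \<open>bounds the image of the ball of radius \<open>L\<close> when \<open>\<parallel>a\<parallel>\<close>, \<open>\<parallel>b\<parallel>\<close> and the length of the interval are enlarged by \<open>\<epsilon>\<close>\<close>
  define \<phi> where "\<phi> \<epsilon> = norm lam + (2 + \<epsilon>) powr \<alpha> / H * ((A + \<epsilon>) * M + (B + \<epsilon>))" for \<epsilon>
  have M0: "M > 0" using \<alpha>0 by (simp add: M_def)
  have \<phi>0: "0 \<le> \<phi> 0" "\<phi> 0 < L" using lt A0 B0 M0 H by (auto simp: \<phi>_def)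
  then have Lpos: "L > 0" by linarith
  \<comment> \<open>any number strictly between \<open>\<phi> 0 / L\<close> and 1 would do\<close>
  define \<theta> where "\<theta> = (\<phi> 0 / L + 1) / 2"
  have \<theta>: "0 < \<theta>" "\<theta> < 1" "\<phi> 0 < \<theta> * L"
    using \<phi>0 Lpos by (auto simp: \<theta>_def field_simps)
  have "isCont \<phi> 0" unfolding \<phi>_def by (intro continuous_intros) (use H in auto)
  then have "(\<phi> \<longlongrightarrow> \<phi> 0) (at_right 0)" by (simp add: isCont_def filterlim_at_split)
  then have "\<forall>\<^sub>F \<epsilon> in at_right 0. \<phi> \<epsilon> < \<theta> * L" using \<theta>(3) by (rule order_tendstoD)
  then obtain \<epsilon> where \<epsilon>: "\<epsilon> > 0" "\<phi> \<epsilon> < \<theta> * L"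
    using eventually_happens[OF eventually_conj[OF _ eventually_at_right_less[of "0::real"]]] by force
  define W where "W = (?\<Omega> \<inter> a -` ball 0 (A + \<epsilon>)) \<inter> (?\<Omega> \<inter> b -` ball 0 (B + \<epsilon>))"
  have "open W" unfolding W_def by (intro open_Int continuous_open_preimage cont \<Omega> open_ball)
  moreover have "complex_of_real ` {-1..1} \<subseteq> W"
  proof
    fix z assume "z \<in> complex_of_real ` {-1..1}"
    then have z: "z \<in> ?K" by (simp add: real_segment_def)
    then have "z \<in> ?\<Omega>" "norm (a z) < A + \<epsilon>" "norm (b z) < B + \<epsilon>"
      using AB[OF z] K\<Omega> \<epsilon> by auto
    then show "z \<in> W" by (simp add: W_def)
  qed
  ultimately obtain e where e: "e > 0" "\<And>D. 0 < D \<Longrightarrow> D \<le> e \<Longrightarrow> sector (-1) 1 D \<subseteq> W"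
    by (rule sector_subset_open) auto
  obtain \<tau> where \<tau>: "\<tau> \<in> {0<..<pi}" "\<And>D. D \<in> {0<..\<tau>} \<Longrightarrow>
      \<exists>N\<ge>1. \<forall>n\<ge>N. \<psi> ` sector_seq (-1) 1 k D (n + 1) \<subseteq> sector_seq (-1) 1 k D n"
    using S unfolding property_S_def by blast
  define D where "D = min (min 1 \<tau>) (min \<epsilon> e)"
  have D: "0 < D" "D \<le> 1" "D \<le> \<epsilon>" "D \<le> e" "D \<in> {0<..\<tau>}" using \<tau> \<epsilon> e by (auto simp: D_def)
  obtain N where N: "N \<ge> 1" "\<And>n. n \<ge> N \<Longrightarrow> \<psi> ` sector_seq (-1) 1 k D (n + 1) \<subseteq> sector_seq (-1) 1 k D n"
    using \<tau>(2)[OF D(5)] by blast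
  have "sector_seq (-1) 1 k D N \<subseteq> sector (-1) 1 D"
  proof -
    have "1 \<le> real N powr (1 / k)" by (rule ge_one_powr_ge_zero) (use N k in auto)
    then have "real N powr (- 1 / k) \<le> 1" using N by (simp add: powr_minus_divide divide_le_eq_1)
    then have "D * real N powr (- 1 / k) \<le> D" using mult_left_mono[of _ 1 D] D by simp
    then show ?thesis unfolding sector_seq_def by (rule sector_mono)
  qed
  also have "\<dots> \<subseteq> W" by (rule e(2)[OF D(1) D(4)])
  finally have SW: "sector_seq (-1) 1 k D N \<subseteq> W" .
  interpret fractional_equation "-1" 1 k \<alpha> D \<theta> L M "(A + \<epsilon>) * M + (B + \<epsilon>)" N lam a b \<psi> \<Phi> ?\<Omega>
  proof
    show "sector_seq (-1) 1 k D N \<subseteq> ?\<Omega>" using SW by (auto simp: W_def)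
    show "complex_of_real ` {-1..1} \<subseteq> ?\<Omega>" using K\<Omega> by (simp add: real_segment_def)
    show "norm (\<Phi> w) \<le> M" if "norm w \<le> L" for w
    proof -
      have "norm (\<Phi> w) \<le> \<alpha>0 * exp (\<beta>0 * norm w)" by (rule growth)
      also have "\<dots> \<le> M" unfolding M_def using that \<alpha>0 \<beta>0 by simp
      finally show ?thesis .
    qed
    show "norm (a z) * M + norm (b z) \<le> (A + \<epsilon>) * M + (B + \<epsilon>)" if "z \<in> sector_seq (-1) 1 k D N" for z
      using that SW M0 by (intro add_mono mult_right_mono) (auto simp: W_def less_imp_le)
    show "norm lam + (1 - (- 1) + D) powr \<alpha> / Gamma (\<alpha> + 1) * ((A + \<epsilon>) * M + (B + \<epsilon>)) < \<theta> * L"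
    proof -
      have "(1 - (- 1) + D) powr \<alpha> / H * ((A + \<epsilon>) * M + (B + \<epsilon>)) \<le> (2 + \<epsilon>) powr \<alpha> / H * ((A + \<epsilon>) * M + (B + \<epsilon>))"
        by (intro mult_right_mono divide_right_mono powr_mono2) (use D \<alpha> H A0 B0 M0 \<epsilon> in auto)
      then show ?thesis using \<epsilon>(2) by (simp add: \<phi>_def H_def)
    qed
  qed (use k \<alpha> D N Lpos \<theta> \<Omega> assms in auto)
  show ?thesis by (rule solution_exists)
qed

end
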